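(* Let $\Lambda>0$, $\eta>0$, and fix finitely many sample points $z_k=x_k+i\eta$, $x_k\in\mathbb{R}$, $k=1,\dots,M$. Let $H_0\equiv\frac12I$ and $\mathcal{S}(H)=(v_{H,\Lambda}(z_k))_{k=1}^M$. Then for every $s_\star\in[0,\Lambda)$ there exists a nonzero step function $q:[0,\Lambda]\to\mathbb{C}$ with $\operatorname{supp}q\subset[s_\star,\Lambda]$ such that $$Dv_{H_0,\Lambda}(z_k)[q]=0,\qquad k=1,\dots,M.$$ For the perturbations $H_\pm^\tau=\frac12I\pm\tau X_q$ on $[0,\Lambda]$ with free tail attached, there are a constant $C$ independent of $\tau$ and a $\tau_0>0$ such that for all $0<\tau\le\tau_0$, $$\|\mathcal{S}(H_+^\tau)-\mathcal{S}(H_-^\tau)\|_2\le C\tau^2,$$ while $\|H_+^\tau-H_-^\tau\|_{L^1(0,\Lambda;\mathrm{op})}\asymp\tau$ (bounded above and below by positive constants times $\tau$). Hence no local inverse-Lipschitz estimate holds: there are no $L^1(0,\Lambda;\mathrm{op})$-neighborhood $U$ of $H_0$ in the class of all free-tail trace-normed Hamiltonians and no $c>0$ such that $\|\mathcal{S}(H_1)-\mathcal{S}(H_2)\|_2\ge c\,\|H_1-H_2\|_{L^1(0,\Lambda;\mathrm{op})}$ for all $H_1,H_2\in U$.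
   Context: Let $J=\begin{pmatrix}0&-1\\1&0\end{pmatrix}$. A trace-normed Hamiltonian on $[0,\Lambda]$ is a measurable $H:[0,\Lambda]\to\mathbb{R}^{2\times2}$ with $H(s)$ symmetric, $H(s)\succeq0$ and $\operatorname{tr}H(s)=1$ for a.e. $s$; it is extended to $[0,\infty)$ by the free tail $H(s)=\frac12I$ for $s\ge\Lambda$ (the "full free-tail class" consists of all such $H$). For $\operatorname{Im}z>0$, the Weyl coefficient $m_{H,\Lambda}(z)$ is the unique $m\in\mathbb{C}$ such that the solution of $JY'(s)=zH(s)Y(s)$ on $[0,\infty)$ with $Y(0)=(1,m)^\top$ is square-integrable, i.e. $\int_0^\infty Y^*HY\,ds<\infty$; it satisfies $\operatorname{Im}m_{H,\Lambda}(z)>0$. Its Schur transform is $v_{H,\Lambda}(z)=\dfrac{m_{H,\Lambda}(z)-i}{m_{H,\Lambda}(z)+i}$. For $q\in\mathbb{C}$, $X_q:=\begin{pmatrix}\operatorname{Re}q&\operatorname{Im}q\\ \operatorname{Im}q&-\operatorname{Re}q\end{pmatrix}$. $Dv_{H_0,\Lambda}(z)[q]$ is the derivative at $\tau=0$ (real $\tau$) of $\tau\mapsto v_{H_0+\tau X_q,\Lambda}(z)$. $\|F\|_{L^1(0,\Lambda;\mathrm{op})}=\int_0^\Lambda\|F(s)\|_{\mathrm{op}}\,ds$, with $\|\cdot\|_{\mathrm{op}}$ the Euclidean operator norm. *)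

theory Defs
  imports "HOL-Analysis.Analysis"
begin

section \<open>Trace-normed Hamiltonians with free tail\<close>

definition Jmat :: "complex^2^2" where
  "Jmat = vector [vector [0, -1], vector [1, 0]]"

(* Only the values of H on [0,L] are relevant; the class is not quotiented by a.e. equality. *)
definition trace_normed :: "real \<Rightarrow> (real \<Rightarrow> real^2^2) \<Rightarrow> bool" where
  "trace_normed L H \<longleftrightarrow>
     H \<in> borel_measurable (lebesgue_on {0..L}) \<and>
     (AE s in lebesgue_on {0..L}.
        transpose (H s) = H s \<and> (\<forall>u. 0 \<le> u \<bullet> (H s *v u)) \<and> trace (H s) = 1)"

definition free_tail :: "real \<Rightarrow> (real \<Rightarrow> real^2^2) \<Rightarrow> real \<Rightarrow> real^2^2" where
  "free_tail L H s = (if s < L then H s else mat (1/2))"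

abbreviation cmat :: "real^2^2 \<Rightarrow> complex^2^2" where
  "cmat \<equiv> map_matrix complex_of_real"


section \<open>Weyl coefficient and Schur transform\<close>

(* Solutions of J Y' = z H Y are understood in the Caratheodory sense (Y locally absolutely
   continuous, equation a.e.), expressed by the equivalent integral equation. *)
definition canonical_solution ::
    "(real \<Rightarrow> real^2^2) \<Rightarrow> complex \<Rightarrow> (real \<Rightarrow> complex^2) \<Rightarrow> bool" where
  "canonical_solution H z Y \<longleftrightarrow>
     (\<forall>t\<ge>0. set_integrable lebesgue {0..t} (\<lambda>s. z *s (cmat (H s) *v Y s)) \<and>
        Jmat *v (Y t - Y 0) = (LINT s:{0..t}|lebesgue. z *s (cmat (H s) *v Y s)))"

(* Y* H Y *)
definition herm_form :: "real^2^2 \<Rightarrow> complex^2 \<Rightarrow> complex" where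
  "herm_form A y = (\<Sum>i\<in>UNIV. cnj (y $ i) * (cmat A *v y) $ i)"

definition weyl :: "real \<Rightarrow> (real \<Rightarrow> real^2^2) \<Rightarrow> complex \<Rightarrow> complex" where
  "weyl L H z =
     (THE m. \<exists>Y. canonical_solution (free_tail L H) z Y \<and> Y 0 = vector [1, m] \<and>
        set_integrable lebesgue {0..} (\<lambda>s. herm_form (free_tail L H s) (Y s)))"

definition schur :: "real \<Rightarrow> (real \<Rightarrow> real^2^2) \<Rightarrow> complex \<Rightarrow> complex" where
  "schur L H z = (weyl L H z - \<i>) / (weyl L H z + \<i>)"

definition sample_map ::
    "real \<Rightarrow> complex^'m \<Rightarrow> (real \<Rightarrow> real^2^2) \<Rightarrow> complex^'m" where
  "sample_map L z H = (\<chi> k. schur L H (z $ k))"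


section \<open>Perturbations and the L1 metric\<close>

definition Xmat :: "complex \<Rightarrow> real^2^2" where
  "Xmat q = vector [vector [Re q, Im q], vector [Im q, - Re q]]"

definition H0 :: "real \<Rightarrow> real^2^2" where
  "H0 s = mat (1/2)"

definition perturb :: "real \<Rightarrow> (real \<Rightarrow> complex) \<Rightarrow> real \<Rightarrow> real^2^2" where
  "perturb \<tau> q s = H0 s + \<tau> *\<^sub>R Xmat (q s)"

definition step_function :: "real \<Rightarrow> real \<Rightarrow> (real \<Rightarrow> complex) \<Rightarrow> bool" where
  "step_function a b q \<longleftrightarrow>
     (\<exists>D. D division_of {a..b} \<and> (\<forall>K\<in>D. q constant_on interior K))"

definition L1_op :: "real \<Rightarrow> (real \<Rightarrow> real^2^2) \<Rightarrow> real" where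
  "L1_op L F = (LINT s:{0..L}|lebesgue. onorm ((*v) (F s)))"

definition L1_nbhd ::
    "real \<Rightarrow> (real \<Rightarrow> real^2^2) \<Rightarrow> (real \<Rightarrow> real^2^2) set \<Rightarrow> bool" where
  "L1_nbhd L H U \<longleftrightarrow>
     U \<subseteq> Collect (trace_normed L) \<and>
     (\<exists>\<epsilon>>0. \<forall>G. trace_normed L G \<and> L1_op L (\<lambda>s. G s - H s) < \<epsilon> \<longrightarrow> G \<in> U)"

end

theory Submission
  imports Defs
begin

text \<open>
  At \<open>H0\<close> the Schur transform vanishes, and along \<open>H0 + \<tau> Xmat q\<close> its first-order term at \<open>z\<close>
  is a constant multiple of the integral of \<open>q s * exp (\<i> * z * s)\<close> over \<open>[0, \<Lambda>]\<close>. A step function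
  with one more piece than there are sample points has enough free coefficients to make all these
  integrals vanish. For such \<open>q\<close> the samples move only by \<open>O(\<tau>\<^sup>2)\<close>, while the Hamiltonian
  moves by a constant times \<open>\<tau>\<close> because \<open>Xmat q\<close> has operator norm \<open>norm q\<close>.

  The Weyl solution is constructed backwards from the free tail as a fixed point of a contraction.
  No other initial value gives a square-integrable solution: the Wronskian with the exponentially
  decaying Weyl solution is constant, which forces any other solution to stay bounded away from zero.
\<close>

section \<open>Backward Volterra systems\<close>

text \<open>In the eigenvectors \<open>(1, \<i>)\<close> and \<open>(1, -\<i>)\<close> of
  \<open>Jmat\<close>, the matrix \<open>Xmat q\<close> swaps the two directions with factors
  \<open>q\<close> and \<open>cnj q\<close>, and the Schur transform of
  \<open>a (1, \<i>) + b (1, -\<i>)\<close> is \<open>-b / a\<close>. The decaying tail solution has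
  \<open>b = 0\<close>, so \<open>b\<close> at 0 arises only through the coupling; its first-order
  part pairs \<open>q\<close> with a product of two free exponentials, hence the kernel
  \<open>exp (\<i> * z * s)\<close>. The derivative for general \<open>q\<close> is never computed.
  Once the integral vanishes, an explicit bound \<open>C * \<tau>\<^sup>2\<close> for both signs of
  \<open>\<tau>\<close> gives the zero derivative and the sample estimate together. Finitely many
  jumps make every solution differentiable off a finite set, so the fundamental theorem of calculus
  replaces a general theory of Caratheodory solutions.\<close>

lemma bounded_borel_absolutely_integrable:
  fixes f :: "real \<Rightarrow> 'b::euclidean_space"
  assumes "f \<in> borel_measurable borel" "\<And>s. s \<in> {a..b} \<Longrightarrow> norm (f s) \<le> K"
  shows "f absolutely_integrable_on {a..b}"
proof (rule measurable_bounded_by_integrable_imp_absolutely_integrable)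
  show "f \<in> borel_measurable (lebesgue_on {a..b})"
    using assms(1) by (intro measurable_restrict_space1 measurable_completion) auto
  show "(\<lambda>_. K) integrable_on {a..b}" by (rule integrable_const_ivl)
qed (use assms in auto)

lemmas bounded_borel_integrable =
  bounded_borel_absolutely_integrable[THEN set_lebesgue_integral_eq_integral(1)]

lemma norm_integral_le_length:
  fixes f :: "real \<Rightarrow> 'b::euclidean_space"
  assumes "f \<in> borel_measurable borel" "\<And>s. norm (f s) \<le> K" "a \<le> b"
  shows "norm (integral {a..b} f) \<le> K * (b - a)"
proof -
  have "norm (integral {a..b} f) \<le> integral {a..b} (\<lambda>_. K)"
    using assms by (intro integral_norm_bound_integral bounded_borel_integrable) auto
  then show ?thesis using assms(3) by (simp add: mult.commute)
qed

text \<open>The clamp \<open>max 0 s\<close> freezes the value for negative \<open>s\<close>, and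
  for \<open>s > L\<close> the interval is empty. For bounded \<open>f\<close> the result is bounded
  and continuous on the whole line, so the fixed-point problem can live in the type of bounded
  continuous functions on \<open>real\<close>.\<close>

definition tail_integral :: "real \<Rightarrow> (real \<Rightarrow> 'b::euclidean_space) \<Rightarrow> real \<Rightarrow> 'b" where
  "tail_integral L f s = integral {max 0 s..L} f"

lemma norm_tail_integral_le:
  fixes f :: "real \<Rightarrow> 'b::euclidean_space"
  assumes f: "f \<in> borel_measurable borel" "\<And>s. norm (f s) \<le> K" and L: "0 \<le> L"
  shows "norm (tail_integral L f s) \<le> K * L"
proof (cases "s \<le> L")
  case True
  have K: "0 \<le> K" by (rule order_trans[OF norm_ge_zero f(2)])
  have "norm (tail_integral L f s) \<le> K * (L - max 0 s)"
    unfolding tail_integral_def using f L True by (intro norm_integral_le_length) auto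
  also have "\<dots> \<le> K * L" using K by (intro mult_left_mono) auto
  finally show ?thesis .
next
  case False
  have K: "0 \<le> K" by (rule order_trans[OF norm_ge_zero f(2)])
  have "{max 0 s..L} = {}" using False by auto
  then show ?thesis using K L by (simp add: tail_integral_def)
qed

text \<open>A bounded integrand makes the integral Lipschitz with constant \<open>K\<close>; the
  three cases locate \<open>L\<close>, beyond which the integral stays 0.\<close>

lemma continuous_on_tail_integral:
  fixes f :: "real \<Rightarrow> 'b::euclidean_space"
  assumes f: "f \<in> borel_measurable borel" "\<And>s. norm (f s) \<le> K"
  shows "continuous_on UNIV (tail_integral L f)"
proof -
  have K: "0 \<le> K" by (rule order_trans[OF norm_ge_zero f(2)])
  define I where "I s = integral {s..L} f" for s
  have *: "norm (I s - I t) \<le> K * (t - s)" if "s \<le> t" for s t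
  proof -
    consider "t \<le> L" | "s \<le> L" "L < t" | "L < s" by linarith
    then show ?thesis
    proof cases
      case 1
      have "I s = integral {s..t} f + I t"
        unfolding I_def using that 1 f
        by (intro Henstock_Kurzweil_Integration.integral_combine[symmetric] bounded_borel_integrable) auto
      then show ?thesis using norm_integral_le_length[OF f that] by simp
    next
      case 2
      have "norm (I s) \<le> K * (L - s)" unfolding I_def by (rule norm_integral_le_length[OF f 2(1)])
      also have "\<dots> \<le> K * (t - s)" using K 2 by (intro mult_left_mono) auto
      finally show ?thesis using 2 by (simp add: I_def)
    next
      case 3
      then show ?thesis using that K by (simp add: I_def)
    qed
  qed
  have "K-lipschitz_on UNIV I"
  proof (rule lipschitz_onI)
    show "dist (I s) (I t) \<le> K * dist s t" for s t
      using *[of s t] *[of t s] by (cases "s \<le> t") (auto simp: dist_norm norm_minus_commute)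
  qed (fact K)
  then have "continuous_on UNIV I" by (rule lipschitz_on_continuous_on)
  then have "continuous_on UNIV (\<lambda>s. I (max 0 s))"
    by (rule continuous_on_compose2[of UNIV I UNIV "max 0"]) (auto intro!: continuous_on_max)
  then show ?thesis by (simp add: I_def tail_integral_def[abs_def])
qed

text \<open>Beyond \<open>L\<close> the integral is locally 0, which agrees with
  \<open>- f s\<close> because \<open>f\<close> vanishes there. The possible corners of the clamped
  integral, 0 and \<open>L\<close>, are left out.\<close>

lemma tail_integral_has_vector_derivative:
  fixes f :: "real \<Rightarrow> 'b::euclidean_space"
  assumes f: "f \<in> borel_measurable borel" "\<And>s. norm (f s) \<le> K"
    and s: "0 < s" "s \<noteq> L" "isCont f s" and zero: "\<And>t. L \<le> t \<Longrightarrow> f t = 0"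
  shows "(tail_integral L f has_vector_derivative - f s) (at s)"
proof (cases "s < L")
  case True
  have int: "f integrable_on {a..b}" for a b
    using f by (intro bounded_borel_integrable) auto
  have "((\<lambda>u. integral {0..u} f) has_vector_derivative f s) (at s within ({0..L} - {}))"
    using s True int by (intro integral_has_vector_derivative_continuous_at)
      (auto intro: continuous_at_imp_continuous_at_within)
  then have "((\<lambda>u. integral {0..u} f) has_vector_derivative f s) (at s)"
    using s True by (simp add: at_within_Icc_at)
  then have "((\<lambda>u. integral {0..L} f - integral {0..u} f) has_vector_derivative 0 - f s) (at s)"
    by (intro has_vector_derivative_diff has_vector_derivative_const)
  then have "((\<lambda>u. integral {0..L} f - integral {0..u} f) has_vector_derivative - f s) (at s)"
    by simp
  then show ?thesis
  proof (rule has_vector_derivative_transform_within_open[of _ _ _ "{0<..<L}"])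
    fix u assume u: "u \<in> {0<..<L}"
    have "integral {0..u} f + integral {u..L} f = integral {0..L} f"
      using u int by (intro Henstock_Kurzweil_Integration.integral_combine) auto
    then show "integral {0..L} f - integral {0..u} f = tail_integral L f u"
      using u by (auto simp: tail_integral_def algebra_simps)
  qed (use s True in auto)
next
  case False
  then have sL: "L < s" using s by simp
  have "((\<lambda>_. 0) has_vector_derivative - f s) (at s)" using zero[of s] sL by simp
  then show ?thesis
    by (rule has_vector_derivative_transform_within_open[of _ _ _ "{L<..}"])
      (use sL in \<open>auto simp: tail_integral_def\<close>)
qed

text \<open>Eliminating \<open>B\<close> leaves one equation \<open>A = T A\<close> in which the
  coupling enters twice. This gives the contraction factor \<open>(\<kappa> * L)\<^sup>2\<close>, at
  most 1/4, and makes \<open>A - 1\<close> of second order in the coupling.\<close>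

lemma volterra_pair:
  fixes g h :: "real \<Rightarrow> complex"
  assumes [measurable]: "g \<in> borel_measurable borel" "h \<in> borel_measurable borel"
    and g: "\<And>s. norm (g s) \<le> \<kappa>" and h: "\<And>s. norm (h s) \<le> \<kappa>"
    and L: "0 \<le> L" and small: "\<kappa> * L \<le> 1/2"
  obtains A B :: "real \<Rightarrow> complex" where
    "continuous_on UNIV A" "continuous_on UNIV B"
    "\<And>s. A s = 1 - tail_integral L (\<lambda>t. g t * B t) s"
    "\<And>s. B s = - tail_integral L (\<lambda>t. h t * A t) s"
    "\<And>s. norm (A s) \<le> 2" "\<And>s. norm (A s - 1) \<le> 2 * (\<kappa> * L)\<^sup>2"
proof -
  have \<kappa>: "0 \<le> \<kappa>" by (rule order_trans[OF norm_ge_zero g])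
  define B :: "(real \<Rightarrow> complex) \<Rightarrow> real \<Rightarrow> complex"
    where "B f = (\<lambda>s. - tail_integral L (\<lambda>t. h t * f t) s)" for f
  define T :: "(real \<Rightarrow> complex) \<Rightarrow> real \<Rightarrow> complex"
    where "T f = (\<lambda>s. 1 - tail_integral L (\<lambda>t. g t * B f t) s)" for f
  have B_le: "norm (B f s) \<le> \<kappa> * D * L" and B_cont: "continuous_on UNIV (B f)"
    if f: "continuous_on UNIV f" "\<And>s. norm (f s) \<le> D" for f D s
  proof -
    have [measurable]: "f \<in> borel_measurable borel"
      using f(1) by (rule borel_measurable_continuous_onI)
    have *: "norm (h t * f t) \<le> \<kappa> * D" for t
      using h[of t] f(2)[of t] \<kappa> by (simp add: norm_mult mult_mono)
    show "norm (B f s) \<le> \<kappa> * D * L" unfolding B_def norm_minus_cancel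
      by (rule norm_tail_integral_le) (use * L in auto)
    show "continuous_on UNIV (B f)" unfolding B_def
      by (intro continuous_on_minus continuous_on_tail_integral[of _ "\<kappa> * D"]) (use * in auto)
  qed
  have T_le: "norm (T f s - 1) \<le> (\<kappa> * L)\<^sup>2 * D" and T_cont: "continuous_on UNIV (T f)"
    if f: "continuous_on UNIV f" "\<And>s. norm (f s) \<le> D" for f D s
  proof -
    have [measurable]: "B f \<in> borel_measurable borel"
      using B_cont[OF f] by (rule borel_measurable_continuous_onI)
    have *: "norm (g t * B f t) \<le> \<kappa> * (\<kappa> * D * L)" for t
      using g[of t] B_le[OF f, of t] \<kappa> by (simp add: norm_mult mult_mono)
    have "norm (T f s - 1) \<le> \<kappa> * (\<kappa> * D * L) * L" unfolding T_def
      using norm_tail_integral_le[of "\<lambda>t. g t * B f t" "\<kappa> * (\<kappa> * D * L)" L s] * L by simp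
    then show "norm (T f s - 1) \<le> (\<kappa> * L)\<^sup>2 * D" by (simp add: power2_eq_square mult_ac)
    show "continuous_on UNIV (T f)" unfolding T_def
      by (intro continuous_on_diff continuous_on_const continuous_on_tail_integral[of _ "\<kappa> * (\<kappa> * D * L)"])
        (use * in auto)
  qed
  have int: "(\<lambda>t. k t * f t) integrable_on {a..b}"
    if "k \<in> borel_measurable borel" "\<And>s. norm (k s) \<le> \<kappa>" "continuous_on UNIV f" "\<And>s. norm (f s) \<le> D"
    for k f :: "real \<Rightarrow> complex" and D a b
  proof (rule bounded_borel_integrable)
    show "(\<lambda>t. k t * f t) \<in> borel_measurable borel"
      using that(1) borel_measurable_continuous_onI[OF that(3)] by measurable
    show "norm (k t * f t) \<le> \<kappa> * D" for t
      using that(2)[of t] that(4)[of t] \<kappa> by (simp add: norm_mult mult_mono)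
  qed
  have B_diff: "B (\<lambda>t. f t - f' t) s = B f s - B f' s"
    if f: "continuous_on UNIV f" "\<And>s. norm (f s) \<le> D"
    and f': "continuous_on UNIV f'" "\<And>s. norm (f' s) \<le> D'" for f f' D D' s
    unfolding B_def tail_integral_def
    using int[OF assms(2) h f] int[OF assms(2) h f']
    by (simp add: algebra_simps Henstock_Kurzweil_Integration.integral_diff)
  \<comment> \<open>\<open>T\<close> is affine with constant term 1, so \<open>T_le\<close> applied
    to a difference of two functions is already the contraction estimate.\<close>
  have T_diff: "T (\<lambda>t. f t - f' t) s - 1 = T f s - T f' s"
    if f: "continuous_on UNIV f" "\<And>s. norm (f s) \<le> D"
    and f': "continuous_on UNIV f'" "\<And>s. norm (f' s) \<le> D'" for f f' D D' s
  proof -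
    have "B (\<lambda>t. f t - f' t) = (\<lambda>s. B f s - B f' s)"
      using B_diff[OF f f'] by blast
    then show ?thesis
      unfolding T_def tail_integral_def
      using int[OF assms(1) g B_cont[OF f] B_le[OF f]] int[OF assms(1) g B_cont[OF f'] B_le[OF f']]
      by (simp add: algebra_simps Henstock_Kurzweil_Integration.integral_diff)
  qed
  have q: "(\<kappa> * L)\<^sup>2 \<le> 1/4"
    using power_mono[OF small, of 2] \<kappa> L by (simp add: power2_eq_square)
  \<comment> \<open>\<open>Bcontfun\<close> is meaningful only on bounded continuous functions; the
    next fact checks this, so that \<open>\<Phi>\<close> is \<open>T\<close> carried over to a
    complete space.\<close>
  define \<Phi> :: "(real \<Rightarrow>\<^sub>C complex) \<Rightarrow> (real \<Rightarrow>\<^sub>C complex)"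
    where "\<Phi> f = Bcontfun (T (apply_bcontfun f))" for f
  have \<Phi>: "apply_bcontfun (\<Phi> f) = T (apply_bcontfun f)" for f
  proof -
    have *: "continuous_on UNIV (apply_bcontfun f)" "\<And>s. norm (apply_bcontfun f s) \<le> norm f"
      by (auto intro: norm_bounded)
    have "norm (T (apply_bcontfun f) s) \<le> 1 + (\<kappa> * L)\<^sup>2 * norm f" for s
      using T_le[OF *, of s] norm_triangle_ineq[of "T (apply_bcontfun f) s - 1" 1] by simp
    then have "T (apply_bcontfun f) \<in> bcontfun"
      using T_cont[OF *] by (intro bcontfun_normI) auto
    then show ?thesis unfolding \<Phi>_def by (rule Bcontfun_inverse)
  qed
  have "\<exists>!f. \<Phi> f = f"
  proof (rule banach_fix_type[of "1/4"])
    show "\<forall>f f'. dist (\<Phi> f) (\<Phi> f') \<le> 1/4 * dist f f'"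
    proof (intro allI dist_bound)
      fix f f' :: "real \<Rightarrow>\<^sub>C complex" and s :: real
      have d: "norm (apply_bcontfun f t - apply_bcontfun f' t) \<le> dist f f'" for t
        using dist_bounded[of f t f'] by (simp add: dist_norm)
      have "dist (apply_bcontfun (\<Phi> f) s) (apply_bcontfun (\<Phi> f') s)
          = norm (T (\<lambda>t. apply_bcontfun f t - apply_bcontfun f' t) s - 1)"
        unfolding \<Phi> dist_norm
        by (subst T_diff[where D="norm f" and D'="norm f'"]) (auto intro: norm_bounded)
      also have "\<dots> \<le> (\<kappa> * L)\<^sup>2 * dist f f'"
        using d by (intro T_le continuous_intros) auto
      also have "\<dots> \<le> 1/4 * dist f f'" using q by (intro mult_right_mono) auto
      finally show "dist (apply_bcontfun (\<Phi> f) s) (apply_bcontfun (\<Phi> f') s) \<le> 1/4 * dist f f'" .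
    qed
  qed auto
  then obtain f where f: "\<Phi> f = f" by blast
  define A where "A = apply_bcontfun f"
  have A: "T A = A" unfolding A_def using \<Phi>[of f] f by simp
  have A_cont: "continuous_on UNIV A" unfolding A_def by simp
  have A_norm: "norm (A s) \<le> norm f" for s unfolding A_def by (rule norm_bounded)
  \<comment> \<open>A priori only \<open>norm f\<close> bounds \<open>A\<close>. Feeding this bound
    into \<open>T_le\<close> gives \<open>norm f\<close> at most 4/3, hence the explicit constant
    2.\<close>
  have "norm (A s) \<le> 1 + 1/4 * norm f" for s
  proof -
    have "norm (A s - 1) \<le> (\<kappa> * L)\<^sup>2 * norm f"
      using T_le[OF A_cont A_norm, of s] A by simp
    also have "\<dots> \<le> 1/4 * norm f" using q by (intro mult_right_mono) auto
    finally show ?thesis using norm_triangle_ineq[of "A s - 1" 1] by simp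
  qed
  then have "norm f \<le> 1 + 1/4 * norm f" unfolding A_def by (rule norm_bound)
  then have A2: "norm (A s) \<le> 2" for s using A_norm[of s] by linarith
  show thesis
  proof
    show "continuous_on UNIV A" by fact
    show "continuous_on UNIV (B A)" by (rule B_cont[OF A_cont A2])
    show "A s = 1 - tail_integral L (\<lambda>t. g t * B A t) s" for s
      using A by (simp add: T_def fun_eq_iff)
    show "B A s = - tail_integral L (\<lambda>t. h t * A t) s" for s by (simp add: B_def)
    show "norm (A s) \<le> 2" for s by (rule A2)
    show "norm (A s - 1) \<le> 2 * (\<kappa> * L)\<^sup>2" for s
      using T_le[OF A_cont A2, of s] A by (simp add: mult.commute)
  qed
qed

section \<open>Canonical systems with finitely many jumps\<close>

lemma vector2_eq_iff: "(v::'a^2) = w \<longleftrightarrow> v $ 1 = w $ 1 \<and> v $ 2 = w $ 2"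
  by (simp add: vec_eq_iff forall_2)

lemma vector2_nth [simp]:
  "(vector [a, b] :: 'a::zero^2) $ 1 = a" "(vector [a, b] :: 'a::zero^2) $ 2 = b"
  by (simp_all add: vector_2)

lemma vec2_continuous_on:
  fixes f :: "'a::topological_space \<Rightarrow> 'b::topological_space^2"
  assumes "continuous_on T (\<lambda>t. f t $ 1)" "continuous_on T (\<lambda>t. f t $ 2)"
  shows "continuous_on T f"
proof -
  have "continuous_on T (\<lambda>t. f t $ i)" for i using assms exhaust_2[of i] by auto
  then have "continuous_on T (\<lambda>t. \<chi> i. f t $ i)" by (intro continuous_on_vec_lambda)
  then show ?thesis by simp
qed

lemma has_vector_derivative_vec_nth:
  assumes "(f has_vector_derivative D) F"
  shows "((\<lambda>t. f t $ i) has_vector_derivative D $ i) F"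
  by (rule bounded_linear.has_vector_derivative[OF bounded_linear_vec_nth assms])

lemma Jmat_mult: "Jmat *v y = vector [- y $ 2, y $ 1]"
  by (simp add: vector2_eq_iff Jmat_def matrix_vector_mult_def sum_2 vector_2)

lemma cmat_perturb_mult:
  "(cmat (perturb \<tau> q s) *v y) $ 1
     = (1/2 + \<tau> * Re (q s)) * y $ 1 + \<tau> * Im (q s) * y $ 2"
  "(cmat (perturb \<tau> q s) *v y) $ 2
     = \<tau> * Im (q s) * y $ 1 + (1/2 - \<tau> * Re (q s)) * y $ 2"
  by (simp_all add: perturb_def H0_def Xmat_def matrix_vector_mult_def sum_2 map_matrix_def
      mat_def vector_2)

lemma herm_form_perturb:
  "herm_form (perturb \<tau> q s) y = cnj (y $ 1) * ((1/2 + \<tau> * Re (q s)) * y $ 1 + \<tau> * Im (q s) * y $ 2)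
     + cnj (y $ 2) * (\<tau> * Im (q s) * y $ 1 + (1/2 - \<tau> * Re (q s)) * y $ 2)"
  by (simp add: herm_form_def sum_2 cmat_perturb_mult)

text \<open>On each bounded interval the pair stays in a compact set, where the continuous
  \<open>\<phi>\<close> is bounded. This serves the right-hand side of the system and the Hermitian
  form alike.\<close>

lemma continuous_image_absolutely_integrable:
  fixes f :: "real \<Rightarrow> 'a::euclidean_space" and g :: "real \<Rightarrow> 'b::euclidean_space"
    and \<phi> :: "'a \<times> 'b \<Rightarrow> 'c::euclidean_space"
  assumes \<phi>: "continuous_on UNIV \<phi>"
    and f: "f \<in> borel_measurable borel" "\<And>s. norm (f s) \<le> K"
    and g: "continuous_on UNIV g"
  shows "(\<lambda>s. \<phi> (f s, g s)) absolutely_integrable_on {a..b}"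
proof -
  have "compact (cball (0::'a) K \<times> g ` {a..b})"
    by (intro compact_Times compact_continuous_image continuous_on_subset[OF g]) auto
  then have "compact (\<phi> ` (cball 0 K \<times> g ` {a..b}))"
    by (intro compact_continuous_image continuous_on_subset[OF \<phi>]) auto
  then obtain M where M: "\<And>v. v \<in> \<phi> ` (cball 0 K \<times> g ` {a..b}) \<Longrightarrow> norm v \<le> M"
    using compact_imp_bounded bounded_iff by metis
  show ?thesis
  proof (rule bounded_borel_absolutely_integrable)
    have [measurable]: "\<phi> \<in> borel_measurable borel" "g \<in> borel_measurable borel"
      using \<phi> g by (auto intro: borel_measurable_continuous_onI)
    have "(\<lambda>s. (f s, g s)) \<in> borel_measurable borel"
      using f(1) by (intro borel_measurable_Pair) auto
    then show "(\<lambda>s. \<phi> (f s, g s)) \<in> borel_measurable borel" by measurable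
    show "norm (\<phi> (f s, g s)) \<le> M" if "s \<in> {a..b}" for s
      using that f(2) by (intro M) auto
  qed
qed

text \<open>The support is kept in \<open>{0..<L}\<close>, open at \<open>L\<close>, to match the
  strict inequality in \<open>free_tail\<close>: attaching the tail then leaves the perturbed
  Hamiltonian unchanged.\<close>

locale finite_jump_potential =
  fixes L K :: real and S :: "real set" and q :: "real \<Rightarrow> complex"
  assumes L_pos: "0 < L"
    and q_meas [measurable]: "q \<in> borel_measurable borel"
    and q_bound: "\<And>s. norm (q s) \<le> K"
    and q_zero: "\<And>s. s \<notin> {0..<L} \<Longrightarrow> q s = 0"
    and finite_S: "finite S"
    and q_cont: "\<And>s. s \<notin> S \<Longrightarrow> isCont q s"
begin

lemma free_tail_perturb: "free_tail L (perturb \<tau> q) = perturb \<tau> q"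
  using q_zero by (auto simp: free_tail_def perturb_def H0_def Xmat_def fun_eq_iff vector2_eq_iff)

text \<open>Written as a function of the potential value and the solution value, the right-hand side
  is jointly continuous although \<open>q\<close> jumps.\<close>

definition hamiltonian_rhs :: "real \<Rightarrow> complex \<Rightarrow> complex \<times> (complex^2) \<Rightarrow> complex^2" where
  "hamiltonian_rhs \<tau> z = (\<lambda>(p, y). z *s vector
     [(1/2 + of_real \<tau> * of_real (Re p)) * y $ 1 + of_real \<tau> * of_real (Im p) * y $ 2,
      of_real \<tau> * of_real (Im p) * y $ 1 + (1/2 - of_real \<tau> * of_real (Re p)) * y $ 2])"

lemma hamiltonian_rhs_eq: "z *s (cmat (perturb \<tau> q s) *v y) = hamiltonian_rhs \<tau> z (q s, y)"
  by (simp add: hamiltonian_rhs_def vector2_eq_iff cmat_perturb_mult)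

lemma hamiltonian_rhs_cont: "continuous_on UNIV (hamiltonian_rhs \<tau> z)"
  by (rule vec2_continuous_on)
    (auto simp: hamiltonian_rhs_def case_prod_unfold intro!: continuous_intros)

lemma canonical_solution_iff_integral:
  "canonical_solution (perturb \<tau> q) z Y \<longleftrightarrow>
    (\<forall>t\<ge>0. (\<lambda>s. hamiltonian_rhs \<tau> z (q s, Y s)) absolutely_integrable_on {0..t} \<and>
      Jmat *v (Y t - Y 0) = integral {0..t} (\<lambda>s. hamiltonian_rhs \<tau> z (q s, Y s)))"
  unfolding canonical_solution_def hamiltonian_rhs_eq
  by (auto simp: set_lebesgue_integral_eq_integral(2))

text \<open>\<open>Jmat\<close> is invertible, so the integral equation expresses each component of
  \<open>Y\<close> as a constant plus an indefinite integral.\<close>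

lemma canonical_solution_continuous:
  assumes "canonical_solution (perturb \<tau> q) z Y"
  shows "continuous_on {0..T} Y"
proof (cases "0 \<le> T")
  case True
  define I where "I t = integral {0..t} (\<lambda>s. hamiltonian_rhs \<tau> z (q s, Y s))" for t
  have sol: "(\<lambda>s. hamiltonian_rhs \<tau> z (q s, Y s)) absolutely_integrable_on {0..t}"
      "Jmat *v (Y t - Y 0) = I t" if "0 \<le> t" for t
    using assms that unfolding canonical_solution_iff_integral I_def by auto
  have I: "continuous_on {0..T} I" unfolding I_def
    using sol(1)[OF True] set_lebesgue_integral_eq_integral(1)
    by (intro indefinite_integral_continuous_1) auto
  have Y: "Y t $ 1 = Y 0 $ 1 + I t $ 2 \<and> Y t $ 2 = Y 0 $ 2 - I t $ 1" if "0 \<le> t" for t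
    using sol(2)[OF that] by (auto simp: Jmat_mult vector2_eq_iff algebra_simps)
  show ?thesis
  proof (rule vec2_continuous_on)
    have "continuous_on {0..T} (\<lambda>t. Y 0 $ 1 + I t $ 2)" using I by (intro continuous_intros)
    then show "continuous_on {0..T} (\<lambda>t. Y t $ 1)"
      by (rule continuous_on_eq) (rule Y[THEN conjunct1, symmetric], simp)
    have "continuous_on {0..T} (\<lambda>t. Y 0 $ 2 - I t $ 1)" using I by (intro continuous_intros)
    then show "continuous_on {0..T} (\<lambda>t. Y t $ 2)"
      by (rule continuous_on_eq) (rule Y[THEN conjunct2, symmetric], simp)
  qed
qed auto

lemma canonical_solution_derivative:
  assumes sol: "canonical_solution (perturb \<tau> q) z Y" and t: "0 < t" "t \<notin> S"
  shows "((\<lambda>t. Y t $ 1) has_vector_derivative hamiltonian_rhs \<tau> z (q t, Y t) $ 2) (at t)"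
    and "((\<lambda>t. Y t $ 2) has_vector_derivative - hamiltonian_rhs \<tau> z (q t, Y t) $ 1) (at t)"
proof -
  define F where "F s = hamiltonian_rhs \<tau> z (q s, Y s)" for s
  define I where "I t = integral {0..t} F" for t
  define T where "T = t + 1"
  have sol': "F absolutely_integrable_on {0..t}"
      "Jmat *v (Y t - Y 0) = I t" if "0 \<le> t" for t
    using assms that unfolding canonical_solution_iff_integral I_def F_def by auto
  have Y: "Y t $ 1 = Y 0 $ 1 + I t $ 2 \<and> Y t $ 2 = Y 0 $ 2 - I t $ 1" if "0 \<le> t" for t
    using sol'(2)[OF that] by (auto simp: Jmat_mult vector2_eq_iff algebra_simps)
  have "continuous_on {0..T} Y" by (rule canonical_solution_continuous[OF sol])
  then have "isCont Y t"
    by (rule continuous_on_interior) (use t in \<open>auto simp: T_def\<close>)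
  then have "isCont (\<lambda>s. (q s, Y s)) t" using q_cont[OF t(2)] by (intro continuous_intros)
  moreover have "isCont (hamiltonian_rhs \<tau> z) (q t, Y t)"
    using hamiltonian_rhs_cont by (simp add: continuous_on_eq_continuous_at)
  ultimately have F: "isCont F t" unfolding F_def by (rule isCont_o2)
  have "(I has_vector_derivative F t) (at t within ({0..T} - {}))" unfolding I_def
    using t F sol'(1)[of T] set_lebesgue_integral_eq_integral(1)
    by (intro integral_has_vector_derivative_continuous_at)
      (auto simp: T_def intro: continuous_at_imp_continuous_at_within)
  then have I: "(I has_vector_derivative F t) (at t)"
    using t by (simp add: at_within_Icc_at T_def)
  note I = has_vector_derivative_vec_nth[OF I]
  have "((\<lambda>t. Y 0 $ 1 + I t $ 2) has_vector_derivative 0 + F t $ 2) (at t)"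
    using I by (intro has_vector_derivative_add has_vector_derivative_const)
  then show "((\<lambda>t. Y t $ 1) has_vector_derivative hamiltonian_rhs \<tau> z (q t, Y t) $ 2) (at t)"
    unfolding F_def add_0
    by (rule has_vector_derivative_transform_within_open[of _ _ _ "{0<..}"])
      (use t in \<open>auto intro: Y[THEN conjunct1, symmetric]\<close>)
  have "((\<lambda>t. Y 0 $ 2 - I t $ 1) has_vector_derivative 0 - F t $ 1) (at t)"
    using I by (intro has_vector_derivative_diff has_vector_derivative_const)
  then show "((\<lambda>t. Y t $ 2) has_vector_derivative - hamiltonian_rhs \<tau> z (q t, Y t) $ 1) (at t)"
    unfolding F_def diff_0
    by (rule has_vector_derivative_transform_within_open[of _ _ _ "{0<..}"])
      (use t in \<open>auto intro: Y[THEN conjunct2, symmetric]\<close>)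
qed

text \<open>Continuity across finitely many exceptional points lets the fundamental theorem of
  calculus recover the integral equation. \<open>R\<close> is separate from \<open>S\<close> so that
  \<open>L\<close>, where the tail integrals were not differentiated, can be added.\<close>

lemma canonical_solutionI:
  assumes cont: "continuous_on UNIV Y" and R: "finite R"
    and d1: "\<And>t. 0 < t \<Longrightarrow> t \<notin> R \<Longrightarrow>
      ((\<lambda>t. Y t $ 1) has_vector_derivative hamiltonian_rhs \<tau> z (q t, Y t) $ 2) (at t)"
    and d2: "\<And>t. 0 < t \<Longrightarrow> t \<notin> R \<Longrightarrow>
      ((\<lambda>t. Y t $ 2) has_vector_derivative - hamiltonian_rhs \<tau> z (q t, Y t) $ 1) (at t)"
  shows "canonical_solution (perturb \<tau> q) z Y"
  unfolding canonical_solution_iff_integral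
proof (intro allI impI conjI)
  fix t :: real assume t: "0 \<le> t"
  let ?F = "\<lambda>s. hamiltonian_rhs \<tau> z (q s, Y s)"
  show F: "?F absolutely_integrable_on {0..t}"
    by (rule continuous_image_absolutely_integrable[OF hamiltonian_rhs_cont q_meas q_bound cont])
  have int: "?F integrable_on {0..t}" by (rule set_lebesgue_integral_eq_integral(1)[OF F])
  have comp: "integral {0..t} ?F $ i = integral {0..t} (\<lambda>s. ?F s $ i)" for i
    using integral_linear[OF int bounded_linear_vec_nth[of i]] by (simp add: o_def)
  have "((\<lambda>s. ?F s $ 2) has_integral (Y t $ 1 - Y 0 $ 1)) {0..t}"
    by (rule fundamental_theorem_of_calculus_interior_strong[OF R t])
      (use d1 cont in \<open>auto intro!: continuous_intros intro: continuous_on_subset\<close>)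
  moreover have "((\<lambda>s. - ?F s $ 1) has_integral (Y t $ 2 - Y 0 $ 2)) {0..t}"
    by (rule fundamental_theorem_of_calculus_interior_strong[OF R t])
      (use d2 cont in \<open>auto intro!: continuous_intros intro: continuous_on_subset\<close>)
  from has_integral_neg[OF this]
  have "((\<lambda>s. ?F s $ 1) has_integral - (Y t $ 2 - Y 0 $ 2)) {0..t}" by simp
  ultimately show "Jmat *v (Y t - Y 0) = integral {0..t} ?F"
    by (simp add: Jmat_mult vector2_eq_iff comp integral_unique)
qed

text \<open>The derivative is \<open>z\<close> times the difference of the bilinear forms
  \<open>X^T H Y\<close> and \<open>Y^T H X\<close>, which agree because \<open>H\<close> is
  symmetric. No conjugation occurs, so nonreal \<open>z\<close> is covered.\<close>

lemma wronskian_constant: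
  assumes Y: "canonical_solution (perturb \<tau> q) z Y" and X: "canonical_solution (perturb \<tau> q) z X"
    and t: "0 \<le> t"
  shows "Y t $ 1 * X t $ 2 - Y t $ 2 * X t $ 1 = Y 0 $ 1 * X 0 $ 2 - Y 0 $ 2 * X 0 $ 1"
proof (rule has_derivative_zero_unique_strong_interval[where a=0 and b=t and k="insert 0 (insert t S)"])
  show "continuous_on {0..t} (\<lambda>t. Y t $ 1 * X t $ 2 - Y t $ 2 * X t $ 1)"
    using canonical_solution_continuous[OF Y] canonical_solution_continuous[OF X]
    by (intro continuous_intros) auto
  fix s assume s: "s \<in> {0..t} - insert 0 (insert t S)"
  then have s': "0 < s" "s \<notin> S" by auto
  have "((\<lambda>t. Y t $ 1 * X t $ 2 - Y t $ 2 * X t $ 1) has_vector_derivative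
      (Y s $ 1 * (- hamiltonian_rhs \<tau> z (q s, X s) $ 1) + hamiltonian_rhs \<tau> z (q s, Y s) $ 2 * X s $ 2)
      - (Y s $ 2 * hamiltonian_rhs \<tau> z (q s, X s) $ 2 + (- hamiltonian_rhs \<tau> z (q s, Y s) $ 1) * X s $ 1)) (at s)"
    by (intro has_vector_derivative_diff has_vector_derivative_mult
        canonical_solution_derivative[OF Y s'] canonical_solution_derivative[OF X s'])
  also have "(Y s $ 1 * (- hamiltonian_rhs \<tau> z (q s, X s) $ 1) + hamiltonian_rhs \<tau> z (q s, Y s) $ 2 * X s $ 2)
      - (Y s $ 2 * hamiltonian_rhs \<tau> z (q s, X s) $ 2 + (- hamiltonian_rhs \<tau> z (q s, Y s) $ 1) * X s $ 1) = 0"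
    by (simp add: hamiltonian_rhs_def algebra_simps)
  finally show "((\<lambda>t. Y t $ 1 * X t $ 2 - Y t $ 2 * X t $ 1) has_derivative (\<lambda>h. 0)) (at s within {0..t})"
    by (auto simp: has_vector_derivative_def intro: has_derivative_at_withinI)
qed (use finite_S t in auto)

end

section \<open>The Weyl coefficient for small perturbations\<close>

lemma absolutely_integrable_ray_lower_bound:
  fixes f :: "real \<Rightarrow> complex"
  assumes f: "f absolutely_integrable_on {a..}" and \<delta>: "\<And>s. a \<le> s \<Longrightarrow> \<delta> \<le> norm (f s)"
  shows "\<delta> \<le> 0"
proof (rule ccontr)
  assume "\<not> \<delta> \<le> 0"
  then have pos: "0 < \<delta>" by simp
  define I where "I = integral {a..} (\<lambda>s. norm (f s))"
  have int: "(\<lambda>s. norm (f s)) integrable_on {a..}"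
    using f by (simp add: absolutely_integrable_on_def)
  have *: "\<delta> * r \<le> I" if "0 \<le> r" for r
  proof -
    have int': "(\<lambda>s. norm (f s)) integrable_on {a..a + r}"
      by (rule integrable_on_subinterval[OF int]) auto
    have "\<delta> * r = integral {a..a + r} (\<lambda>_. \<delta>)" using that by (simp add: mult.commute)
    also have "\<dots> \<le> integral {a..a + r} (\<lambda>s. norm (f s))"
      by (rule integral_le) (use int' \<delta> in auto)
    also have "\<dots> \<le> I" unfolding I_def by (rule integral_subset_le) (use int int' in auto)
    finally show ?thesis .
  qed
  have "0 \<le> I" using *[of 0] by simp
  \<comment> \<open>The length \<open>I / \<delta> + 1\<close> is chosen so that the lower bound
    exceeds \<open>I\<close> by exactly \<open>\<delta>\<close>.\<close>
  then have "\<delta> * (I / \<delta> + 1) \<le> I" using pos by (intro *) auto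
  moreover have "\<delta> * (I / \<delta> + 1) = I + \<delta>" using pos by (simp add: distrib_left)
  ultimately show False using pos by simp
qed

lemma norm_exp_ii_mult: "norm (exp (\<i> * z * of_real s)) = exp (- Im z * s)"
  by (simp add: norm_exp_eq_Re)

lemma exp_mult_has_vector_derivative:
  fixes w :: complex
  shows "((\<lambda>s. exp (w * of_real s)) has_vector_derivative w * exp (w * of_real s)) (at s within T)"
  by (rule has_vector_derivative_real_field[of "\<lambda>x. exp (w * x)"]) (auto intro!: derivative_eq_intros)

context finite_jump_potential
begin

lemma K_nonneg: "0 \<le> K"
  by (rule order_trans[OF norm_ge_zero q_bound])

lemma herm_form_free:
  assumes "L \<le> s"
  shows "herm_form (perturb \<tau> q s) y = of_real (((norm (y $ 1))\<^sup>2 + (norm (y $ 2))\<^sup>2) / 2)"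
proof -
  have "q s = 0" using assms by (intro q_zero) auto
  then show ?thesis
    using complex_norm_square[of "y $ 1"] complex_norm_square[of "y $ 2"]
    by (simp add: herm_form_perturb field_simps)
qed

text \<open>On the free tail the form is half the squared Euclidean norm, so components of rate
  \<open>Im z / 2\<close> give a majorant of rate \<open>Im z\<close>; on \<open>{0..L}\<close>
  boundedness is enough.\<close>

lemma herm_form_integrable:
  assumes cont: "continuous_on UNIV Y" and z: "0 < Im z"
    and Y: "\<And>s i. L \<le> s \<Longrightarrow> norm (Y s $ i) \<le> c * exp (- (Im z / 2) * s)"
  shows "set_integrable lebesgue {0..} (\<lambda>s. herm_form (perturb \<tau> q s) (Y s))"
proof -
  let ?h = "\<lambda>s. herm_form (perturb \<tau> q s) (Y s)"
  define \<psi> :: "complex \<times> (complex^2) \<Rightarrow> complex" where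
    "\<psi> = (\<lambda>(p, y). cnj (y $ 1) * ((1/2 + of_real \<tau> * of_real (Re p)) * y $ 1 + of_real \<tau> * of_real (Im p) * y $ 2)
     + cnj (y $ 2) * (of_real \<tau> * of_real (Im p) * y $ 1 + (1/2 - of_real \<tau> * of_real (Re p)) * y $ 2))"
  have \<psi>: "?h s = \<psi> (q s, Y s)" for s by (simp add: \<psi>_def herm_form_perturb)
  have \<psi>_cont: "continuous_on UNIV \<psi>"
    unfolding \<psi>_def case_prod_unfold by (intro continuous_intros)
  have 1: "?h absolutely_integrable_on {0..L}" unfolding \<psi>
    by (rule continuous_image_absolutely_integrable[OF \<psi>_cont q_meas q_bound cont])
  have 2: "?h absolutely_integrable_on {L..}"
  proof (rule measurable_bounded_by_integrable_imp_absolutely_integrable)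
    have [measurable]: "\<psi> \<in> borel_measurable borel" "Y \<in> borel_measurable borel"
      using \<psi>_cont cont by (auto intro: borel_measurable_continuous_onI)
    have "(\<lambda>s. (q s, Y s)) \<in> borel_measurable borel"
      by (intro borel_measurable_Pair) auto
    then have "?h \<in> borel_measurable borel" unfolding \<psi> by measurable
    then show "?h \<in> borel_measurable (lebesgue_on {L..})"
      by (intro measurable_restrict_space1 measurable_completion) auto
    show "(\<lambda>s. c\<^sup>2 * exp (- Im z * s)) integrable_on {L..}"
      using integrable_on_exp_minus_to_infinity[OF z, of L] by (intro integrable_on_mult_right) auto
    fix s assume "s \<in> {L..}"
    then have s: "L \<le> s" by simp
    have sq: "(norm (Y s $ i))\<^sup>2 \<le> c\<^sup>2 * exp (- Im z * s)" for i
      using power_mono[OF Y[OF s, of i], of 2]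
      by (simp add: power_mult_distrib exp_double[symmetric])
    show "norm (?h s) \<le> c\<^sup>2 * exp (- Im z * s)"
      using sq[of 1] sq[of 2] unfolding herm_form_free[OF s] norm_of_real by simp
  qed auto
  have "set_integrable lebesgue ({0..L} \<union> {L..}) ?h"
    using 1 2 by (intro set_integrable_Un) auto
  moreover have "{0..L} \<union> {L..} = {0..}" using L_pos by auto
  ultimately show ?thesis by simp
qed

lemma weyl_eqI:
  assumes z: "0 < Im z"
    and sol: "canonical_solution (perturb \<tau> q) z Y" and cont: "continuous_on UNIV Y"
    and Y0: "Y 0 = vector [1, m]"
    and Y: "\<And>s i. L \<le> s \<Longrightarrow> norm (Y s $ i) \<le> c * exp (- (Im z / 2) * s)"
  shows "weyl L (perturb \<tau> q) z = m"
  unfolding weyl_def free_tail_perturb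
proof (rule the_equality)
  show "\<exists>Y. canonical_solution (perturb \<tau> q) z Y \<and> Y 0 = vector [1, m] \<and>
      set_integrable lebesgue {0..} (\<lambda>s. herm_form (perturb \<tau> q s) (Y s))"
    using sol Y0 herm_form_integrable[OF cont z Y] by blast
  fix m' assume "\<exists>Y. canonical_solution (perturb \<tau> q) z Y \<and> Y 0 = vector [1, m'] \<and>
      set_integrable lebesgue {0..} (\<lambda>s. herm_form (perturb \<tau> q s) (Y s))"
  then obtain X where X: "canonical_solution (perturb \<tau> q) z X" "X 0 = vector [1, m']"
    and int: "set_integrable lebesgue {0..} (\<lambda>s. herm_form (perturb \<tau> q s) (X s))" by blast
  have int: "(\<lambda>s. herm_form (perturb \<tau> q s) (X s)) absolutely_integrable_on {L..}"
    using L_pos by (intro set_integrable_subset[OF int]) auto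
  show "m' = m"
  proof (rule ccontr)
    assume "m' \<noteq> m"
    then have d: "0 < norm (m' - m)" by simp
    \<comment> \<open>The Wronskian of \<open>Y\<close> and the competitor \<open>X\<close> is
      \<open>m' - m\<close> at 0, hence everywhere; on the tail the components of \<open>Y\<close>
      are at most \<open>c\<close>.\<close>
    have low: "norm (m' - m) \<le> c * (norm (X s $ 1) + norm (X s $ 2))" if s: "L \<le> s" for s
    proof -
      have c: "0 \<le> c * exp (- (Im z / 2) * s)"
        by (rule order_trans[OF norm_ge_zero Y[OF s]])
      then have c0: "0 \<le> c" by (simp add: zero_le_mult_iff)
      have "c * exp (- (Im z / 2) * s) \<le> c * 1"
        using c0 z s L_pos by (intro mult_left_mono) auto
      then have Yc: "norm (Y s $ i) \<le> c" for i using Y[OF s, of i] by simp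
      have "m' - m = Y s $ 1 * X s $ 2 - Y s $ 2 * X s $ 1"
        using wronskian_constant[OF sol X(1), of s] s L_pos Y0 X(2) by simp
      then have "norm (m' - m) \<le> norm (Y s $ 1) * norm (X s $ 2) + norm (Y s $ 2) * norm (X s $ 1)"
        using norm_triangle_ineq4 by (simp add: norm_mult[symmetric])
      also have "\<dots> \<le> c * norm (X s $ 2) + c * norm (X s $ 1)"
        using Yc by (intro add_mono mult_right_mono) auto
      finally show ?thesis by (simp add: algebra_simps)
    qed
    have "0 < c"
    proof (rule ccontr)
      assume "\<not> 0 < c"
      then have "c * (norm (X L $ 1) + norm (X L $ 2)) \<le> 0" by (intro mult_nonpos_nonneg) auto
      then show False using low[of L] d by simp
    qed
    \<comment> \<open>The form on the tail is \<open>(a\<^sup>2 + b\<^sup>2) / 2\<close>, which is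
      at least \<open>(a + b)\<^sup>2 / 4\<close>; this is the origin of the factor 1/4.\<close>
    define \<delta> where "\<delta> = (norm (m' - m) / c)\<^sup>2 / 4"
    have "\<delta> \<le> 0"
    proof (rule absolutely_integrable_ray_lower_bound[OF int])
      fix s assume s: "L \<le> s"
      define a b where "a = norm (X s $ 1)" and "b = norm (X s $ 2)"
      have "norm (m' - m) / c \<le> a + b"
        using low[OF s] \<open>0 < c\<close> by (simp add: a_def b_def field_simps)
      then have "(norm (m' - m) / c)\<^sup>2 \<le> (a + b)\<^sup>2"
        using \<open>0 < c\<close> by (intro power_mono) auto
      also have "\<dots> \<le> 2 * (a\<^sup>2 + b\<^sup>2)"
        using zero_le_power2[of "a - b"] by (simp add: power2_eq_square algebra_simps)
      finally have "\<delta> \<le> (a\<^sup>2 + b\<^sup>2) / 2" by (simp add: \<delta>_def)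
      then show "\<delta> \<le> norm (herm_form (perturb \<tau> q s) (X s))"
        unfolding herm_form_free[OF s] norm_of_real a_def b_def by linarith
    qed
    then show False using d \<open>0 < c\<close> by (simp add: \<delta>_def divide_le_0_iff)
  qed
qed

text \<open>In the coordinates \<open>Y = a (1, \<i>) + b (1, -\<i>)\<close> the system reads
  \<open>a' = \<i>z/2 a + \<i>z\<tau> cnj q b\<close>, \<open>b' = -\<i>z/2 b - \<i>z\<tau> q a\<close>; removing the free exponentials
  from \<open>a\<close> and \<open>b\<close> leaves a small Volterra system, solved backwards from \<open>a = 1\<close>, \<open>b = 0\<close> at \<open>L\<close>.\<close>

lemma norm_schur_perturb_le:
  fixes \<tau> :: real
  assumes z: "0 < Im z" and orth: "integral {0..L} (\<lambda>s. q s * exp (\<i> * z * of_real s)) = 0"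
    and \<kappa>: "\<kappa> = \<bar>\<tau>\<bar> * (norm z * K * exp (Im z * L))" and small: "\<kappa> * L \<le> 1/8"
  shows "norm (schur L (perturb \<tau> q) z) \<le> (\<kappa> * L)\<^sup>2"
proof -
  \<comment> \<open>Removing the free exponentials multiplies each coupling by a quotient of the
    two, which is why \<open>z\<close> and not \<open>z / 2\<close> stands in the exponents.\<close>
  define g where "g s = \<i> * z * \<tau> * cnj (q s) * exp (- \<i> * z * of_real s)" for s :: real
  define h where "h s = - \<i> * z * \<tau> * q s * exp (\<i> * z * of_real s)" for s :: real
  have \<kappa>_nonneg: "0 \<le> \<kappa>" using K_nonneg by (simp add: \<kappa>)
  \<comment> \<open>The growing factor \<open>exp (Im z * s)\<close> in the norm of \<open>g\<close>
    is controlled only up to \<open>L\<close>; elsewhere \<open>q\<close> vanishes.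
    \<open>\<kappa>\<close> is tailored to \<open>g\<close>, and \<open>h\<close>, whose factor
    decays, satisfies the same bound.\<close>
  have bound: "\<bar>\<tau>\<bar> * norm z * norm (q s) * e \<le> \<kappa>"
    if "0 \<le> e" "0 \<le> s \<Longrightarrow> s < L \<Longrightarrow> e \<le> exp (Im z * L)" for e s
  proof (cases "s \<in> {0..<L}")
    case True
    then have "norm (q s) * e \<le> K * exp (Im z * L)"
      using that q_bound[of s] K_nonneg by (intro mult_mono) auto
    then have "(\<bar>\<tau>\<bar> * norm z) * (norm (q s) * e) \<le> (\<bar>\<tau>\<bar> * norm z) * (K * exp (Im z * L))"
      by (intro mult_left_mono) auto
    then show ?thesis by (simp add: \<kappa> mult.assoc)
  next
    case False
    then show ?thesis using q_zero[of s] \<kappa>_nonneg by simp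
  qed
  have g_le: "norm (g s) \<le> \<kappa>" for s
  proof -
    have "norm (g s) = \<bar>\<tau>\<bar> * norm z * norm (q s) * exp (Im z * s)"
      by (simp add: g_def norm_mult mult_ac)
    also have "\<dots> \<le> \<kappa>" by (rule bound) (use z in auto)
    finally show ?thesis .
  qed
  have h_le: "norm (h s) \<le> \<kappa>" for s
  proof -
    have "norm (h s) = \<bar>\<tau>\<bar> * norm z * norm (q s) * exp (- Im z * s)"
      by (simp add: h_def norm_mult mult_ac)
    also have "\<dots> \<le> \<kappa>"
    proof (rule bound)
      assume "0 \<le> s" "s < L"
      then have "- Im z * s \<le> 0" "0 \<le> Im z * L" using z L_pos by auto
      then show "exp (- Im z * s) \<le> exp (Im z * L)" unfolding exp_le_cancel_iff by linarith
    qed simp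
    finally show ?thesis .
  qed
  have [measurable]: "(\<lambda>s. cnj (q s)) \<in> borel_measurable borel"
    by (rule measurable_compose[OF q_meas]) (intro borel_measurable_continuous_onI continuous_intros)
  have [measurable]: "(\<lambda>s. exp (w * complex_of_real s)) \<in> borel_measurable borel" for w
    by (intro borel_measurable_continuous_onI continuous_intros)
  have g_meas [measurable]: "g \<in> borel_measurable borel"
    unfolding g_def by measurable
  have h_meas [measurable]: "h \<in> borel_measurable borel"
    unfolding h_def by measurable
  have half: "\<kappa> * L \<le> 1/2" using small by simp
  obtain A B where A_cont: "continuous_on UNIV A" and B_cont: "continuous_on UNIV B"
    and A: "\<And>s. A s = 1 - tail_integral L (\<lambda>t. g t * B t) s"
    and B: "\<And>s. B s = - tail_integral L (\<lambda>t. h t * A t) s"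
    and A_le: "\<And>s. norm (A s) \<le> 2" and A1_le: "\<And>s. norm (A s - 1) \<le> 2 * (\<kappa> * L)\<^sup>2"
    by (rule volterra_pair[OF g_meas h_meas g_le h_le less_imp_le[OF L_pos] half], rule that)
  have [measurable]: "A \<in> borel_measurable borel" "B \<in> borel_measurable borel"
    using A_cont B_cont by (auto intro: borel_measurable_continuous_onI)
  have hA_le: "norm (h s * A s) \<le> \<kappa> * 2" for s
    using h_le[of s] A_le[of s] \<kappa>_nonneg by (simp add: norm_mult mult_mono)
  have B_le: "norm (B s) \<le> \<kappa> * 2 * L" for s
    unfolding B norm_minus_cancel by (rule norm_tail_integral_le) (use hA_le L_pos in auto)
  have gB_le: "norm (g s * B s) \<le> \<kappa> * (\<kappa> * 2 * L)" for s
    using g_le[of s] B_le[of s] \<kappa>_nonneg by (simp add: norm_mult mult_mono)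

  \<comment> \<open>The first-order part of \<open>B 0\<close> is the integral of \<open>h\<close>,
    a multiple of the integral in \<open>orth\<close>. The remainder contains \<open>A - 1\<close>
    and is even cubic in \<open>\<kappa>\<close>; the surplus factor
    \<open>2 * (\<kappa> * L)\<close> is spent on the constant 1/4.\<close>
  have "B 0 = - integral {0..L} (\<lambda>t. h t * A t)" by (simp add: B tail_integral_def)
  also have "integral {0..L} (\<lambda>t. h t * A t) = integral {0..L} (\<lambda>t. h t * (A t - 1) + h t)"
    by (simp add: algebra_simps)
  also have "\<dots> = integral {0..L} (\<lambda>t. h t * (A t - 1)) + integral {0..L} h"
  proof (rule integral_add)
    have "norm (h t * (A t - 1)) \<le> \<kappa> * (2 * (\<kappa> * L)\<^sup>2)" for t
      unfolding norm_mult using h_le A1_le \<kappa>_nonneg by (intro mult_mono) auto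
    then show "(\<lambda>t. h t * (A t - 1)) integrable_on {0..L}"
      by (intro bounded_borel_integrable) auto
    show "h integrable_on {0..L}" using h_le by (intro bounded_borel_integrable) auto
  qed
  also have "integral {0..L} h = - \<i> * z * \<tau> * integral {0..L} (\<lambda>s. q s * exp (\<i> * z * of_real s))"
    unfolding h_def integral_mult_right[symmetric] by (simp add: mult_ac)
  also have "\<dots> = 0" by (simp add: orth)
  finally have "norm (B 0) = norm (integral {0..L} (\<lambda>t. h t * (A t - 1)))" by simp
  also have "\<dots> \<le> \<kappa> * (2 * (\<kappa> * L)\<^sup>2) * (L - 0)"
  proof (rule norm_integral_le_length)
    show "norm (h t * (A t - 1)) \<le> \<kappa> * (2 * (\<kappa> * L)\<^sup>2)" for t
      unfolding norm_mult using h_le A1_le \<kappa>_nonneg by (intro mult_mono) auto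
  qed (use L_pos in auto)
  also have "\<dots> = (2 * (\<kappa> * L)) * (\<kappa> * L)\<^sup>2" by simp
  also have "\<dots> \<le> (1/4) * (\<kappa> * L)\<^sup>2"
    using small by (intro mult_right_mono) auto
  finally have B0: "norm (B 0) \<le> (1/4) * (\<kappa> * L)\<^sup>2" .
  have sq: "(\<kappa> * L)\<^sup>2 \<le> (1/8)\<^sup>2"
    using small \<kappa>_nonneg L_pos by (intro power_mono) auto
  have "norm (1::complex) \<le> norm (A 0) + norm (1 - A 0)"
    using norm_triangle_ineq[of "A 0" "1 - A 0"] by simp
  then have A0: "1/2 \<le> norm (A 0)"
    using A1_le[of 0] sq by (simp add: norm_minus_commute power2_eq_square)
  \<comment> \<open>\<open>c\<close> is the first component at 0 before normalization; dividing by
    it gives the initial value \<open>(1, m)\<close> demanded by \<open>weyl\<close>. It is nonzero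
    because \<open>B 0\<close> is much smaller than \<open>A 0\<close>.\<close>
  define c where "c = A 0 + B 0"
  have c: "c \<noteq> 0"
  proof
    assume "c = 0"
    then have "A 0 = - B 0" unfolding c_def by (rule eq_neg_iff_add_eq_0[THEN iffD2])
    then have "norm (A 0) = norm (B 0)" by simp
    then show False using A0 B0 sq by (simp add: power2_eq_square)
  qed

  define a b where "a s = exp (\<i> * z / 2 * of_real s) * A s"
    and "b s = exp (- \<i> * z / 2 * of_real s) * B s" for s :: real
  define Y :: "real \<Rightarrow> complex^2" where "Y s = vector [(a s + b s) / c, \<i> * (a s - b s) / c]" for s
  have Y_cont: "continuous_on UNIV Y"
    by (rule vec2_continuous_on)
      (auto simp: Y_def a_def b_def c intro!: continuous_intros A_cont B_cont)
  have der: "(a has_vector_derivative \<i> * z / 2 * a s + \<i> * z * \<tau> * cnj (q s) * b s) (at s)"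
      "(b has_vector_derivative - \<i> * z / 2 * b s - \<i> * z * \<tau> * q s * a s) (at s)"
    if s: "0 < s" "s \<notin> insert L S" for s
  proof -
    have cont: "isCont g s" "isCont h s" "isCont A s" "isCont B s"
      using q_cont[of s] s A_cont B_cont unfolding g_def h_def
      by (auto simp: continuous_on_eq_continuous_at intro!: continuous_intros)
    have zero: "g t = 0" "h t = 0" if "L \<le> t" for t
      using q_zero[of t] that by (auto simp: g_def h_def)
    have "(tail_integral L (\<lambda>t. g t * B t) has_vector_derivative - (g s * B s)) (at s)"
      by (rule tail_integral_has_vector_derivative[OF _ gB_le]) (use s cont zero in auto)
    from has_vector_derivative_diff[OF has_vector_derivative_const[of 1] this]
    have dA: "(A has_vector_derivative g s * B s) (at s)" by (simp flip: A)
    have "(tail_integral L (\<lambda>t. h t * A t) has_vector_derivative - (h s * A s)) (at s)"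
      by (rule tail_integral_has_vector_derivative[OF _ hA_le]) (use s cont zero in auto)
    from has_vector_derivative_minus[OF this]
    have dB: "(B has_vector_derivative h s * A s) (at s)" by (simp flip: B)
    have "\<i> * z / 2 * of_real s + - \<i> * z * of_real s = - \<i> * z / 2 * of_real s"
      by (simp add: field_simps)
    then have E: "exp (\<i> * z / 2 * of_real s) * exp (- \<i> * z * of_real s) = exp (- \<i> * z / 2 * of_real s)"
      by (metis exp_add)
    then have gB: "exp (\<i> * z / 2 * of_real s) * (g s * B s) = \<i> * z * \<tau> * cnj (q s) * b s"
      unfolding g_def b_def E[symmetric] by (simp only: mult_ac)
    have "- \<i> * z / 2 * of_real s + \<i> * z * of_real s = \<i> * z / 2 * of_real s"
      by (simp add: field_simps)
    then have E': "exp (- \<i> * z / 2 * of_real s) * exp (\<i> * z * of_real s) = exp (\<i> * z / 2 * of_real s)"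
      by (metis exp_add)
    then have hA: "exp (- \<i> * z / 2 * of_real s) * (h s * A s) = - \<i> * z * \<tau> * q s * a s"
      unfolding h_def a_def E'[symmetric] by (simp only: mult_ac)
    have "(a has_vector_derivative exp (\<i> * z / 2 * of_real s) * (g s * B s)
        + \<i> * z / 2 * exp (\<i> * z / 2 * of_real s) * A s) (at s)"
      unfolding a_def by (intro has_vector_derivative_mult exp_mult_has_vector_derivative dA)
    then show "(a has_vector_derivative \<i> * z / 2 * a s + \<i> * z * \<tau> * cnj (q s) * b s) (at s)"
      unfolding gB by (simp add: a_def algebra_simps)
    have "(b has_vector_derivative exp (- \<i> * z / 2 * of_real s) * (h s * A s)
        + - \<i> * z / 2 * exp (- \<i> * z / 2 * of_real s) * B s) (at s)"
      unfolding b_def by (intro has_vector_derivative_mult exp_mult_has_vector_derivative dB)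
    then show "(b has_vector_derivative - \<i> * z / 2 * b s - \<i> * z * \<tau> * q s * a s) (at s)"
      unfolding hA by (rule back_subst[where P="\<lambda>D. (b has_vector_derivative D) (at s)"])
        (simp add: b_def algebra_simps)
  qed
  have sol: "canonical_solution (perturb \<tau> q) z Y"
  proof (rule canonical_solutionI[OF Y_cont])
    show "finite (insert L S)" using finite_S by simp
    fix s assume s: "0 < s" "s \<notin> insert L S"
    define r i where "r = complex_of_real (Re (q s))" and "i = complex_of_real (Im (q s))"
    have qs: "q s = r + \<i> * i" "cnj (q s) = r - \<i> * i"
      by (simp_all add: r_def i_def complex_eq_iff)
    have rhs: "hamiltonian_rhs \<tau> z (q s, Y s) = z *s vector
        [(1/2 + \<tau> * r) * ((a s + b s) / c) + \<tau> * i * (\<i> * (a s - b s) / c),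
         \<tau> * i * ((a s + b s) / c) + (1/2 - \<tau> * r) * (\<i> * (a s - b s) / c)]"
      by (simp add: hamiltonian_rhs_def r_def i_def Y_def)
    have ii: "\<i> * \<i> = -1" by simp
    have "((\<lambda>t. (a t + b t) / c) has_vector_derivative
        ((\<i> * z / 2 * a s + \<i> * z * \<tau> * cnj (q s) * b s) + (- \<i> * z / 2 * b s - \<i> * z * \<tau> * q s * a s)) / c) (at s)"
      by (intro has_vector_derivative_divide has_vector_derivative_add der s)
    moreover have "((\<i> * z / 2 * a s + \<i> * z * \<tau> * cnj (q s) * b s) + (- \<i> * z / 2 * b s - \<i> * z * \<tau> * q s * a s)) / c
        = hamiltonian_rhs \<tau> z (q s, Y s) $ 2"
      \<comment> \<open>The order matters: \<open>cnj (q s)\<close> is rewritten before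
        \<open>q s\<close>, whose replacement would hide it. What remains is field algebra in
        \<open>r\<close> and \<open>i\<close>.\<close>
      unfolding rhs unfolding qs(2) unfolding qs(1) using c by (simp add: field_simps)
    ultimately show "((\<lambda>t. Y t $ 1) has_vector_derivative hamiltonian_rhs \<tau> z (q s, Y s) $ 2) (at s)"
      by (simp add: Y_def)
    have "((\<lambda>t. \<i> * (a t - b t) / c) has_vector_derivative
        \<i> * ((\<i> * z / 2 * a s + \<i> * z * \<tau> * cnj (q s) * b s) - (- \<i> * z / 2 * b s - \<i> * z * \<tau> * q s * a s)) / c) (at s)"
      by (intro has_vector_derivative_divide has_vector_derivative_mult_right has_vector_derivative_diff der s)
    moreover have "\<i> * ((\<i> * z / 2 * a s + \<i> * z * \<tau> * cnj (q s) * b s) - (- \<i> * z / 2 * b s - \<i> * z * \<tau> * q s * a s)) / c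
        = - hamiltonian_rhs \<tau> z (q s, Y s) $ 1"
      unfolding rhs unfolding qs(2) unfolding qs(1) using c by (simp add: field_simps)
    ultimately show "((\<lambda>t. Y t $ 2) has_vector_derivative - hamiltonian_rhs \<tau> z (q s, Y s) $ 1) (at s)"
      by (simp add: Y_def)
  qed
  have "weyl L (perturb \<tau> q) z = \<i> * (A 0 - B 0) / c"
  proof (rule weyl_eqI[OF z sol Y_cont])
    show "Y 0 = vector [1, \<i> * (A 0 - B 0) / c]"
      using c by (simp add: Y_def a_def b_def c_def)
    \<comment> \<open>From \<open>L\<close> on both tail integrals vanish, which leaves the pure
      decaying exponential divided by \<open>c\<close>.\<close>
    fix s and j :: 2 assume s: "L \<le> s"
    have "A s = 1" "B s = 0"
    proof -
      have "tail_integral L (\<lambda>t. g t * B t) s = 0" "tail_integral L (\<lambda>t. h t * A t) s = 0"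
        using s L_pos by (cases "s = L"; auto simp: tail_integral_def max_def)+
      then show "A s = 1" "B s = 0" using A[of s] B[of s] by simp_all
    qed
    then have "norm (Y s $ j) = exp (- (Im z / 2) * s) / norm c"
      using exhaust_2[of j] by (auto simp: Y_def a_def b_def norm_mult norm_divide)
    then show "norm (Y s $ j) \<le> (1 / norm c) * exp (- (Im z / 2) * s)" by simp
  qed
  then have "schur L (perturb \<tau> q) z = (\<i> * (A 0 - B 0) / c - \<i>) / (\<i> * (A 0 - B 0) / c + \<i>)"
    by (simp add: schur_def)
  also have "\<dots> = - B 0 / A 0"
  proof -
    have "\<i> * (A 0 - B 0) / c - \<i> = - (2 * \<i> * B 0) / c" "\<i> * (A 0 - B 0) / c + \<i> = 2 * \<i> * A 0 / c"
      using c by (simp_all add: field_simps) (simp_all add: c_def algebra_simps)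
    then show ?thesis using c by simp
  qed
  finally have "norm (schur L (perturb \<tau> q) z) = norm (B 0) / norm (A 0)"
    by (simp add: norm_divide)
  also have "\<dots> \<le> ((1/4) * (\<kappa> * L)\<^sup>2) / (1/2)"
    using A0 B0 by (intro frac_le) auto
  also have "\<dots> \<le> (\<kappa> * L)\<^sup>2" by simp
  finally show ?thesis .
qed

lemma norm_schur_perturb_quadratic:
  assumes z: "0 < Im z" and orth: "integral {0..L} (\<lambda>s. q s * exp (\<i> * z * of_real s)) = 0"
  obtains C \<tau>0 where "0 < \<tau>0" "0 \<le> C"
    "\<And>\<tau>. \<bar>\<tau>\<bar> \<le> \<tau>0 \<Longrightarrow> norm (schur L (perturb \<tau> q) z) \<le> C * \<tau>\<^sup>2"
proof
  define G where "G = norm z * K * exp (Im z * L)"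
  have GL: "0 \<le> G * L" using K_nonneg L_pos by (simp add: G_def)
  \<comment> \<open>This radius keeps \<open>\<bar>\<tau>\<bar> * G * L\<close> at most 1/8, as the
    preceding estimate requires; the summand 1 covers the case \<open>G * L = 0\<close>.\<close>
  show "0 < 1 / (8 * (G * L + 1))" using GL by simp
  show "0 \<le> (G * L)\<^sup>2" by simp
  fix \<tau> :: real assume \<tau>: "\<bar>\<tau>\<bar> \<le> 1 / (8 * (G * L + 1))"
  have "\<bar>\<tau>\<bar> * (G * L) \<le> 1 / (8 * (G * L + 1)) * (G * L + 1)"
    using \<tau> GL by (intro mult_mono) auto
  also have "\<dots> = 1/8" using GL by (simp add: field_simps)
  finally have "(\<bar>\<tau>\<bar> * G) * L \<le> 1/8" by (simp add: mult.assoc)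
  from norm_schur_perturb_le[OF z orth _ this]
  show "norm (schur L (perturb \<tau> q) z) \<le> (G * L)\<^sup>2 * \<tau>\<^sup>2"
    by (simp add: G_def power_mult_distrib mult_ac)
qed

end

section \<open>Step potentials and the L1 distance\<close>

lemma continuous_on_Xmat: "continuous_on T Xmat"
  by (rule vec2_continuous_on; rule vec2_continuous_on)
    (simp_all add: Xmat_def continuous_on_Re continuous_on_Im continuous_on_minus)

text \<open>A symmetric traceless 2 by 2 matrix is a scaled reflection; here the scale is
  \<open>norm p\<close>.\<close>

lemma norm_Xmat_mult: "norm (Xmat p *v u) = norm p * norm u"
proof -
  have "(norm (Xmat p *v u))\<^sup>2 = (norm p * norm u)\<^sup>2"
    unfolding power_mult_distrib cmod_power2 power2_norm_eq_inner
    by (simp add: Xmat_def inner_vec_def sum_2 matrix_vector_mult_def) algebra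
  then show ?thesis by (simp add: power2_eq_iff_nonneg)
qed

lemma onorm_Xmat: "onorm ((*v) (Xmat p)) = norm p"
proof (rule antisym)
  show "onorm ((*v) (Xmat p)) \<le> norm p"
    by (rule onorm_le) (simp add: norm_Xmat_mult)
  have "norm (Xmat p *v axis 1 1) \<le> onorm ((*v) (Xmat p)) * norm (axis 1 1 :: real^2)"
    by (rule onorm) (rule matrix_vector_mul_bounded_linear)
  then show "norm p \<le> onorm ((*v) (Xmat p))" by (simp add: norm_Xmat_mult norm_axis_1)
qed

lemma perturb_diff: "perturb \<tau> q s - perturb \<sigma> q s = Xmat (of_real (\<tau> - \<sigma>) * q s)"
  by (simp add: perturb_def Xmat_def vector2_eq_iff algebra_simps)

lemma perturb_0: "perturb 0 q = H0"
  by (simp add: perturb_def fun_eq_iff)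

text \<open>Distances along the perturbation line are exactly linear in the parameter, so the
  two-sided estimate will hold with equal constants.\<close>

lemma L1_op_perturb_diff:
  "L1_op L (\<lambda>s. perturb \<tau> q s - perturb \<sigma> q s) = \<bar>\<tau> - \<sigma>\<bar> * (LINT s:{0..L}|lebesgue. norm (q s))"
  unfolding L1_op_def perturb_diff onorm_Xmat norm_mult norm_of_real
  by (rule set_integral_mult_right)

context finite_jump_potential
begin

lemma L1_norm_pos:
  assumes "\<not> (AE s in lebesgue_on {0..L}. q s = 0)"
  shows "0 < (LINT s:{0..L}|lebesgue. norm (q s))"
proof -
  have "q absolutely_integrable_on {0..L}"
    using q_bound by (intro bounded_borel_absolutely_integrable) auto
  then have int: "integrable (lebesgue_on {0..L}) (\<lambda>s. norm (q s))"
    by (auto simp: set_integrable_def integrable_restrict_space intro: integrable_norm)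
  have "(LINT s:{0..L}|lebesgue. norm (q s)) = integral\<^sup>L (lebesgue_on {0..L}) (\<lambda>s. norm (q s))"
    by (simp add: set_lebesgue_integral_def integral_restrict_space)
  moreover have "integral\<^sup>L (lebesgue_on {0..L}) (\<lambda>s. norm (q s)) \<noteq> 0"
    using assms integral_nonneg_eq_0_iff_AE[OF int] by simp
  moreover have "0 \<le> integral\<^sup>L (lebesgue_on {0..L}) (\<lambda>s. norm (q s))" by simp
  ultimately show ?thesis by linarith
qed

text \<open>The eigenvalues at \<open>s\<close> are \<open>1/2 + \<tau> * norm (q s)\<close> and
  \<open>1/2 - \<tau> * norm (q s)\<close>, nonnegative under the assumption, and
  \<open>Xmat\<close> is traceless.\<close>

lemma trace_normed_perturb:
  assumes "\<bar>\<tau>\<bar> * K \<le> 1/2"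
  shows "trace_normed L (perturb \<tau> q)"
  unfolding trace_normed_def
proof
  have "Xmat \<in> borel_measurable borel"
    by (rule borel_measurable_continuous_onI[OF continuous_on_Xmat])
  then have [measurable]: "(\<lambda>s. Xmat (q s)) \<in> borel_measurable borel"
    by (rule measurable_compose[OF q_meas])
  have "perturb \<tau> q \<in> borel_measurable borel"
    unfolding perturb_def H0_def by measurable
  then show "perturb \<tau> q \<in> borel_measurable (lebesgue_on {0..L})"
    by (intro measurable_restrict_space1 measurable_completion) auto
  have "0 \<le> u \<bullet> (perturb \<tau> q s *v u)" for s u
  proof -
    have "perturb \<tau> q s *v u = (1/2) *\<^sub>R u + \<tau> *\<^sub>R (Xmat (q s) *v u)"
      by (simp add: perturb_def H0_def vector2_eq_iff matrix_vector_mult_def sum_2 mat_def algebra_simps)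
    then have "u \<bullet> (perturb \<tau> q s *v u) = (1/2) * (norm u)\<^sup>2 + \<tau> * (u \<bullet> (Xmat (q s) *v u))"
      by (simp add: inner_add_right power2_norm_eq_inner)
    moreover have "\<bar>\<tau> * (u \<bullet> (Xmat (q s) *v u))\<bar> \<le> (1/2) * (norm u)\<^sup>2"
    proof -
      have "\<bar>u \<bullet> (Xmat (q s) *v u)\<bar> \<le> norm u * (norm (q s) * norm u)"
        using Cauchy_Schwarz_ineq2[of u "Xmat (q s) *v u"] by (simp add: norm_Xmat_mult)
      also have "\<dots> \<le> norm u * (K * norm u)"
        using q_bound by (intro mult_left_mono mult_right_mono) auto
      finally have "\<bar>\<tau> * (u \<bullet> (Xmat (q s) *v u))\<bar> \<le> \<bar>\<tau>\<bar> * (norm u * (K * norm u))"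
        unfolding abs_mult by (intro mult_left_mono) auto
      also have "\<dots> = (\<bar>\<tau>\<bar> * K) * (norm u)\<^sup>2" by (simp add: power2_eq_square)
      also have "\<dots> \<le> (1/2) * (norm u)\<^sup>2" using assms by (intro mult_right_mono) auto
      finally show ?thesis .
    qed
    ultimately show ?thesis by linarith
  qed
  moreover have "transpose (perturb \<tau> q s) = perturb \<tau> q s" "trace (perturb \<tau> q s) = 1" for s
    by (simp_all add: vector2_eq_iff transpose_def trace_def sum_2 perturb_def H0_def Xmat_def mat_def)
  ultimately show "AE s in lebesgue_on {0..L}. transpose (perturb \<tau> q s) = perturb \<tau> q s \<and>
      (\<forall>u. 0 \<le> u \<bullet> (perturb \<tau> q s *v u)) \<and> trace (perturb \<tau> q s) = 1"
    by simp
qed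

end

section \<open>Step functions with prescribed linear relations\<close>

lemma nontrivial_vanishing_combination:
  fixes V :: "nat \<Rightarrow> complex^'m"
  obtains c :: "nat \<Rightarrow> complex" and j where
    "j \<le> CARD('m)" "c j \<noteq> 0" "(\<Sum>j\<le>CARD('m). c j *s V j) = 0"
proof -
  define n where "n = CARD('m)"
  have "card (UNIV :: 'm option set) = card {..n}" by (simp add: n_def card_option)
  then obtain e where e: "bij_betw e (UNIV :: 'm option set) {..n}"
    using finite_same_card_bij[of "UNIV :: 'm option set" "{..n}"] by auto
  \<comment> \<open>The index type \<open>'m option\<close> supplies one extra coordinate. Counting
    real dimensions, \<open>2 * (CARD('m) + 1)\<close> against \<open>2 * CARD('m)\<close>,
    suffices, since a nonzero kernel vector of the real-linear map has complex coordinates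
    anyway.\<close>
  define f :: "complex^('m option) \<Rightarrow> complex^'m" where "f x = (\<Sum>i\<in>UNIV. x $ i *s V (e i))" for x
  have lin: "linear f"
    by (rule linearI)
      (simp_all add: f_def sum.distrib vector_sadd_rdistrib scaleR_sum_right vec_eq_iff algebra_simps)
  have "\<not> inj f"
  proof
    assume "inj f"
    then have "dim (f ` UNIV) = dim (UNIV :: (complex^('m option)) set)"
      using lin by (intro dim_image_eq) auto
    moreover have "dim (f ` UNIV) \<le> DIM(complex^'m)" by (rule dim_subset_UNIV)
    ultimately show False by (simp add: dim_UNIV card_option)
  qed
  then obtain x where x: "f x = 0" "x \<noteq> 0"
    using linear_injective_0[OF lin] by blast
  then obtain i where i: "x $ i \<noteq> 0" by (auto simp: vec_eq_iff)
  define c where "c j = x $ inv_into UNIV e j" for j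
  have ce: "c (e i) = x $ i" for i
    unfolding c_def using e by (simp add: bij_betw_def inv_into_f_f)
  show thesis
  proof (rule that[of "e i" c])
    show "e i \<le> CARD('m)" using e unfolding bij_betw_def n_def by auto
    show "c (e i) \<noteq> 0" using i by (simp add: ce)
    have "(\<Sum>j\<le>n. c j *s V j) = (\<Sum>i\<in>UNIV. c (e i) *s V (e i))"
      by (rule sum.reindex_bij_betw[OF e, symmetric])
    then show "(\<Sum>j\<le>CARD('m). c j *s V j) = 0" using x(1) by (simp add: ce f_def n_def)
  qed
qed

text \<open>Half-open pieces avoid double counting at the nodes and give 0 at the right end
  \<open>t (Suc n)\<close>, where the free tail begins.\<close>

definition pieces :: "(nat \<Rightarrow> real) \<Rightarrow> nat \<Rightarrow> (nat \<Rightarrow> complex) \<Rightarrow> real \<Rightarrow> complex" where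
  "pieces t n c s = (\<Sum>j\<le>n. c j * of_real (indicator {t j..<t (Suc j)} s))"

context
  fixes t :: "nat \<Rightarrow> real"
  assumes t: "strict_mono t"
begin

lemma pieces_eq:
  assumes "i \<le> n" "s \<in> {t i..<t (Suc i)}"
  shows "pieces t n c s = c i"
proof -
  have "indicator {t j..<t (Suc j)} s = (if j = i then 1 else 0 :: real)" for j
  proof -
    have "j = i" if "s \<in> {t j..<t (Suc j)}"
    proof -
      have "t j < t (Suc i)" "t i < t (Suc j)" using that assms(2) by auto
      then show ?thesis using t by (simp add: strict_mono_less)
    qed
    then have "s \<in> {t j..<t (Suc j)} \<longleftrightarrow> j = i" using assms(2) by blast
    then show ?thesis by (simp add: indicator_def)
  qed
  then show ?thesis using assms(1) by (simp add: pieces_def if_distrib[of of_real] if_distrib[of "(*) _"] cong: if_cong)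
qed

lemma pieces_zero:
  assumes "s \<notin> {t 0..<t (Suc n)}"
  shows "pieces t n c s = 0"
proof -
  have "s \<notin> {t j..<t (Suc j)}" if "j \<le> n" for j
  proof -
    have "t 0 \<le> t j" "t (Suc j) \<le> t (Suc n)"
      using t that by (auto simp: strict_mono_less_eq)
    then show ?thesis using assms by auto
  qed
  then show ?thesis by (simp add: pieces_def)
qed

lemma isCont_pieces:
  assumes "s \<notin> t ` {..Suc n}"
  shows "isCont (pieces t n c) s"
proof -
  have *: "isCont (\<lambda>s. indicator {t j..<t (Suc j)} s :: real) s" if "j \<le> n" for j
  proof -
    have "t j < t (Suc j)" using t by (simp add: strict_mono_less)
    moreover have "s \<noteq> t j" "s \<noteq> t (Suc j)" using assms that by auto
    ultimately have "s \<notin> frontier {t j..<t (Suc j)}"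
      by (auto simp: frontier_def closure_atLeastLessThan interior_atLeastLessThan)
    then show ?thesis by (simp add: isCont_indicator)
  qed
  show ?thesis unfolding pieces_def
    by (intro continuous_intros) (use * in auto)
qed

lemma pieces_measurable [measurable]: "pieces t n c \<in> borel_measurable borel"
  unfolding pieces_def by measurable

lemma norm_pieces_le: "norm (pieces t n c s) \<le> (\<Sum>j\<le>n. norm (c j))"
  unfolding pieces_def by (rule sum_norm_le) (simp add: norm_mult indicator_def)

text \<open>Closed intervals are appended one node at a time. The first one,
  \<open>{0..t 0}\<close>, carries the value 0 in its interior and degenerates to a point when
  \<open>t 0 = 0\<close>.\<close>

lemma step_function_pieces:
  assumes "0 \<le> t 0"
  shows "step_function 0 (t (Suc n)) (pieces t n c)"
proof -
  have "\<exists>D. D division_of {0..t k} \<and> (\<forall>K\<in>D. pieces t n c constant_on interior K)" if "k \<le> Suc n" for k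
    using that
  proof (induction k)
    case 0
    have "pieces t n c s = 0" if "s \<in> interior {0..t 0}" for s
      using that by (intro pieces_zero) auto
    moreover have "{{0..t 0}} division_of {0..t 0}"
      using division_of_self[of 0 "t 0"] assms by simp
    ultimately show ?case by (intro exI[of _ "{{0..t 0}}"]) (auto simp: constant_on_def)
  next
    case (Suc k)
    then obtain D where D: "D division_of {0..t k}" "\<forall>K\<in>D. pieces t n c constant_on interior K"
      by auto
    have less: "0 \<le> t k" "t k < t (Suc k)"
      using assms t strict_mono_less_eq[OF t, of 0 k] by (auto simp: strict_mono_less)
    have "{{t k..t (Suc k)}} division_of {t k..t (Suc k)}"
      using division_of_self[of "t k" "t (Suc k)"] less by simp
    then have "D \<union> {{t k..t (Suc k)}} division_of {0..t k} \<union> {t k..t (Suc k)}"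
      using D(1) by (intro division_disjoint_union) auto
    moreover have "{0..t k} \<union> {t k..t (Suc k)} = {0..t (Suc k)}" using less by auto
    moreover have "pieces t n c s = c k" if "s \<in> interior {t k..t (Suc k)}" for s
      using that Suc.prems by (intro pieces_eq) auto
    ultimately show ?case using D(2)
      by (intro exI[of _ "D \<union> {{t k..t (Suc k)}}"]) (auto simp: constant_on_def)
  qed
  then show ?thesis unfolding step_function_def by blast
qed

lemma pieces_not_AE_zero:
  assumes "i \<le> n" "c i \<noteq> 0" "0 \<le> t 0" "t (Suc n) = L"
  shows "\<not> (AE s in lebesgue_on {0..L}. pieces t n c s = 0)"
proof
  assume "AE s in lebesgue_on {0..L}. pieces t n c s = 0"
  then have "AE s in lebesgue. s \<in> {0..L} \<longrightarrow> pieces t n c s = 0"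
    by (simp add: AE_restrict_space_iff)
  then have "AE s in lebesgue. s \<notin> {t i..<t (Suc i)}"
  proof (rule AE_mp, intro AE_I2 impI notI)
    fix s assume *: "s \<in> {0..L} \<longrightarrow> pieces t n c s = 0" "s \<in> {t i..<t (Suc i)}"
    have "t 0 \<le> t i" "t (Suc i) \<le> t (Suc n)"
      using t assms(1) by (auto simp: strict_mono_less_eq)
    then show False using * pieces_eq[OF assms(1) *(2), of c] assms by auto
  qed
  then have "{t i..<t (Suc i)} \<in> null_sets lebesgue"
    by (subst (asm) AE_iff_null_sets[symmetric]) auto
  then have "emeasure lborel {t i..<t (Suc i)} = 0" by (auto simp: null_sets_def)
  moreover have "t i < t (Suc i)" using t by (simp add: strict_mono_less)
  ultimately show False by simp
qed

end

section \<open>Second-order invisible perturbations and failure of inverse stability\<close>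

lemma has_vector_derivative_zero_quadratic:
  fixes f :: "real \<Rightarrow> 'a::real_normed_vector"
  assumes "0 < \<tau>0" and f: "\<And>\<tau>. \<bar>\<tau>\<bar> \<le> \<tau>0 \<Longrightarrow> norm (f \<tau>) \<le> C * \<tau>\<^sup>2"
  shows "(f has_vector_derivative 0) (at 0)"
proof -
  have f0: "f 0 = 0" using f[of 0] assms(1) by simp
  have "(f has_derivative (\<lambda>h. 0)) (at 0 within UNIV)"
  proof (rule has_derivativeI_sandwich[OF assms(1)])
    show "((\<lambda>\<tau>. C * \<bar>\<tau>\<bar>) \<longlongrightarrow> 0) (at 0 within UNIV)"
      by (auto intro!: tendsto_eq_intros)
    fix \<tau> :: real assume "\<tau> \<noteq> 0" "dist \<tau> 0 < \<tau>0"
    then have "norm (f \<tau>) \<le> C * \<bar>\<tau>\<bar> * \<bar>\<tau>\<bar>"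
      using f[of \<tau>] by (simp add: power2_eq_square mult.assoc)
    then show "norm (f \<tau> - f 0 - 0) / norm (\<tau> - 0) \<le> C * \<bar>\<tau>\<bar>"
      using \<open>\<tau> \<noteq> 0\<close> by (simp add: f0 divide_le_eq)
  qed auto
  then show ?thesis by (simp add: has_vector_derivative_def)
qed

text \<open>Collects what both halves of the theorem need about one \<open>q\<close>. The bounds are
  stated for \<open>\<bar>\<tau>\<bar>\<close>, so they cover both signs and the derivative at
  0.\<close>

lemma exists_second_order_invisible_step:
  fixes z :: "complex^'m"
  assumes s0: "0 \<le> s0" "s0 < \<Lambda>" and z: "\<And>k. 0 < Im (z $ k)"
  obtains q C \<tau>0 N where
    "step_function 0 \<Lambda> q" "\<not> (AE s in lebesgue_on {0..\<Lambda>}. q s = 0)"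
    "{s. q s \<noteq> 0} \<subseteq> {s0..\<Lambda>}" "0 < \<tau>0" "0 < N"
    "\<And>\<tau>. \<bar>\<tau>\<bar> \<le> \<tau>0 \<Longrightarrow> trace_normed \<Lambda> (perturb \<tau> q)"
    "\<And>k \<tau>. \<bar>\<tau>\<bar> \<le> \<tau>0 \<Longrightarrow> norm (schur \<Lambda> (perturb \<tau> q) (z $ k)) \<le> C * \<tau>\<^sup>2"
    "\<And>\<tau> \<sigma>. L1_op \<Lambda> (\<lambda>s. perturb \<tau> q s - perturb \<sigma> q s) = \<bar>\<tau> - \<sigma>\<bar> * N"
proof -
  define n where "n = CARD('m)"
  define t where "t j = s0 + real j * ((\<Lambda> - s0) / real (Suc n))" for j
  have t: "strict_mono t" unfolding t_def using s0
    by (intro strict_monoI add_strict_left_mono mult_strict_right_mono) auto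
  have t_ends: "t 0 = s0" "t (Suc n) = \<Lambda>" by (simp_all add: t_def field_simps)
  \<comment> \<open>Coordinate \<open>k\<close> of \<open>V j\<close> is the integral of the kernel
    at \<open>z $ k\<close> over piece \<open>j\<close>, so one linear relation among these vectors
    makes the integrals vanish at all sample points simultaneously.\<close>
  define V :: "nat \<Rightarrow> complex^'m" where
    "V j = (\<chi> k. integral {0..\<Lambda>} (\<lambda>s. of_real (indicator {t j..<t (Suc j)} s) * exp (\<i> * z $ k * of_real s)))" for j
  obtain c i where c: "i \<le> n" "c i \<noteq> 0" "(\<Sum>j\<le>n. c j *s V j) = 0"
    using nontrivial_vanishing_combination[of V] unfolding n_def by blast
  define q where "q = pieces t n c"
  define K where "K = (\<Sum>j\<le>n. norm (c j))"
  have K: "0 \<le> K" unfolding K_def by (intro sum_nonneg) auto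
  have supp: "q s = 0" if "s \<notin> {s0..<\<Lambda>}" for s
    using pieces_zero[OF t, of s n c] that by (simp add: q_def t_ends)
  interpret finite_jump_potential \<Lambda> K "t ` {..Suc n}" q
  proof
    show "q \<in> borel_measurable borel" unfolding q_def by (rule pieces_measurable[OF t])
    show "norm (q s) \<le> K" for s unfolding q_def K_def by (rule norm_pieces_le[OF t])
    show "q s = 0" if "s \<notin> {0..<\<Lambda>}" for s using supp that s0 by auto
    show "isCont q s" if "s \<notin> t ` {..Suc n}" for s
      unfolding q_def using that by (rule isCont_pieces[OF t])
  qed (use s0 in auto)
  have orth: "integral {0..\<Lambda>} (\<lambda>s. q s * exp (\<i> * z $ k * of_real s)) = 0" for k
  proof -
    let ?e = "\<lambda>j s. of_real (indicator {t j..<t (Suc j)} s) * exp (\<i> * z $ k * of_real s)"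
    have int: "?e j integrable_on {0..\<Lambda>}" for j
    proof (rule bounded_borel_integrable)
      have [measurable]: "(\<lambda>s. exp (\<i> * z $ k * complex_of_real s)) \<in> borel_measurable borel"
        by (intro borel_measurable_continuous_onI continuous_intros)
      show "?e j \<in> borel_measurable borel" by measurable
      fix s assume "s \<in> {0..\<Lambda>}"
      then have "norm (exp (\<i> * z $ k * of_real s)) \<le> 1"
        unfolding norm_exp_ii_mult using z[of k] by simp
      then show "norm (?e j s) \<le> 1" by (simp add: norm_mult indicator_def)
    qed
    have "integral {0..\<Lambda>} (\<lambda>s. q s * exp (\<i> * z $ k * of_real s))
        = integral {0..\<Lambda>} (\<lambda>s. \<Sum>j\<le>n. c j * ?e j s)"
      by (simp add: q_def pieces_def sum_distrib_right mult.assoc)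
    also have "\<dots> = (\<Sum>j\<le>n. integral {0..\<Lambda>} (\<lambda>s. c j * ?e j s))"
      by (rule integral_sum) (use int in \<open>auto intro: integrable_on_mult_right\<close>)
    also have "\<dots> = (\<Sum>j\<le>n. c j *s V j) $ k" by (simp add: V_def)
    finally show ?thesis by (simp add: c(3))
  qed
  have "\<exists>C \<tau>0. 0 < \<tau>0 \<and> 0 \<le> C \<and>
      (\<forall>\<tau>. \<bar>\<tau>\<bar> \<le> \<tau>0 \<longrightarrow> norm (schur \<Lambda> (perturb \<tau> q) (z $ k)) \<le> C * \<tau>\<^sup>2)" for k
    using norm_schur_perturb_quadratic[OF z orth] by metis
  then obtain C \<tau>1 where C: "\<And>k. 0 < \<tau>1 k" "\<And>k. 0 \<le> C k"
      "\<And>k \<tau>. \<bar>\<tau>\<bar> \<le> \<tau>1 k \<Longrightarrow> norm (schur \<Lambda> (perturb \<tau> q) (z $ k)) \<le> C k * \<tau>\<^sup>2"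
    by metis
  \<comment> \<open>The first term secures positive semidefiniteness, the second the quadratic bound
    at every sample point.\<close>
  define \<tau>0 where "\<tau>0 = min (1 / (2 * (K + 1))) (Min (range \<tau>1))"
  define N where "N = (LINT s:{0..\<Lambda>}|lebesgue. norm (q s))"
  have nz: "\<not> (AE s in lebesgue_on {0..\<Lambda>}. q s = 0)"
    unfolding q_def using c s0 t_ends by (intro pieces_not_AE_zero[OF t, of i]) auto
  show thesis
  proof (rule that[of q \<tau>0 N "\<Sum>k\<in>UNIV. C k"])
    show "step_function 0 \<Lambda> q"
      using step_function_pieces[OF t, of n c] s0 by (simp add: t_ends q_def)
    show "{s. q s \<noteq> 0} \<subseteq> {s0..\<Lambda>}" using supp by fastforce
    show "0 < \<tau>0" using C(1) K by (auto simp: \<tau>0_def)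
    show "0 < N" unfolding N_def by (rule L1_norm_pos[OF nz])
    show "trace_normed \<Lambda> (perturb \<tau> q)" if "\<bar>\<tau>\<bar> \<le> \<tau>0" for \<tau>
    proof (rule trace_normed_perturb)
      have "\<bar>\<tau>\<bar> * K \<le> 1 / (2 * (K + 1)) * (K + 1)"
        using that K by (intro mult_mono) (auto simp: \<tau>0_def)
      also have "\<dots> = 1/2" using K by (simp add: field_simps)
      finally show "\<bar>\<tau>\<bar> * K \<le> 1/2" .
    qed
    show "norm (schur \<Lambda> (perturb \<tau> q) (z $ k)) \<le> (\<Sum>k\<in>UNIV. C k) * \<tau>\<^sup>2" if "\<bar>\<tau>\<bar> \<le> \<tau>0" for k \<tau>
    proof -
      have "\<tau>0 \<le> \<tau>1 k" unfolding \<tau>0_def by (intro min.coboundedI2 Min_le) auto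
      then have "norm (schur \<Lambda> (perturb \<tau> q) (z $ k)) \<le> C k * \<tau>\<^sup>2" using that by (intro C) auto
      also have "\<dots> \<le> (\<Sum>k\<in>UNIV. C k) * \<tau>\<^sup>2"
        using C(2) by (intro mult_right_mono member_le_sum) auto
      finally show ?thesis .
    qed
    show "L1_op \<Lambda> (\<lambda>s. perturb \<tau> q s - perturb \<sigma> q s) = \<bar>\<tau> - \<sigma>\<bar> * N" for \<tau> \<sigma>
      unfolding N_def by (rule L1_op_perturb_diff)
  qed (fact nz)
qed

lemma norm_sample_map_diff_le:
  fixes z :: "complex^'m" and \<epsilon> :: real
  assumes "\<And>k. norm (schur L G (z $ k)) \<le> \<epsilon>" "\<And>k. norm (schur L H (z $ k)) \<le> \<epsilon>"
  shows "norm (sample_map L z G - sample_map L z H) \<le> 2 * CARD('m) * \<epsilon>"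
proof -
  have "norm (sample_map L z G - sample_map L z H)
      \<le> (\<Sum>k\<in>UNIV. norm ((sample_map L z G - sample_map L z H) $ k))"
    unfolding norm_vec_def by (rule L2_set_le_sum) simp
  also have "\<dots> \<le> (\<Sum>k\<in>(UNIV :: 'm set). 2 * \<epsilon>)"
  proof (rule sum_mono)
    fix k
    have "norm (schur L G (z $ k) - schur L H (z $ k)) \<le> \<epsilon> + \<epsilon>"
      by (rule order_trans[OF norm_triangle_ineq4 add_mono[OF assms]])
    then show "norm ((sample_map L z G - sample_map L z H) $ k) \<le> 2 * \<epsilon>"
      by (simp add: sample_map_def)
  qed
  finally show ?thesis by simp
qed

theorem theorem1p4:
  fixes \<Lambda> \<eta> :: real and x :: "real^'m" and z :: "complex^'m"
  assumes "\<Lambda> > 0" and "\<eta> > 0"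
    and "z = (\<chi> k. Complex (x $ k) \<eta>)"
  shows
    "(\<forall>s0\<in>{0..<\<Lambda>}. \<exists>q.
        step_function 0 \<Lambda> q \<and>
        \<not> (AE s in lebesgue_on {0..\<Lambda>}. q s = 0) \<and>
        closure {s\<in>{0..\<Lambda>}. q s \<noteq> 0} \<subseteq> {s0..\<Lambda>} \<and>
        (\<forall>k. ((\<lambda>\<tau>. schur \<Lambda> (perturb \<tau> q) (z $ k)) has_vector_derivative 0) (at 0)) \<and>
        (\<exists>C \<tau>0 a b. \<tau>0 > 0 \<and> a > 0 \<and> b > 0 \<and>
           (\<forall>\<tau>. 0 < \<tau> \<and> \<tau> \<le> \<tau>0 \<longrightarrow>
              trace_normed \<Lambda> (perturb \<tau> q) \<and> trace_normed \<Lambda> (perturb (- \<tau>) q) \<and>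
              norm (sample_map \<Lambda> z (perturb \<tau> q) - sample_map \<Lambda> z (perturb (- \<tau>) q))
                \<le> C * \<tau>\<^sup>2 \<and>
              a * \<tau> \<le> L1_op \<Lambda> (\<lambda>s. perturb \<tau> q s - perturb (- \<tau>) q s) \<and>
              L1_op \<Lambda> (\<lambda>s. perturb \<tau> q s - perturb (- \<tau>) q s) \<le> b * \<tau>)))
     \<and> \<not> (\<exists>U c. c > 0 \<and> L1_nbhd \<Lambda> H0 U \<and>
           (\<forall>H1\<in>U. \<forall>H2\<in>U.
              c * L1_op \<Lambda> (\<lambda>s. H1 s - H2 s)
                \<le> norm (sample_map \<Lambda> z H1 - sample_map \<Lambda> z H2)))"
proof (intro conjI ballI notI)
  have z: "0 < Im (z $ k)" for k using assms by simp
  fix s0 assume "s0 \<in> {0..<\<Lambda>}"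
  then have s0: "0 \<le> s0" "s0 < \<Lambda>" by auto
  obtain q C \<tau>0 N where q: "step_function 0 \<Lambda> q" "\<not> (AE s in lebesgue_on {0..\<Lambda>}. q s = 0)"
    and supp: "{s. q s \<noteq> 0} \<subseteq> {s0..\<Lambda>}" and pos: "0 < \<tau>0" "0 < N"
    and tr: "\<And>\<tau>. \<bar>\<tau>\<bar> \<le> \<tau>0 \<Longrightarrow> trace_normed \<Lambda> (perturb \<tau> q)"
    and schur: "\<And>k \<tau>. \<bar>\<tau>\<bar> \<le> \<tau>0 \<Longrightarrow> norm (schur \<Lambda> (perturb \<tau> q) (z $ k)) \<le> C * \<tau>\<^sup>2"
    and L1: "\<And>\<tau> \<sigma>. L1_op \<Lambda> (\<lambda>s. perturb \<tau> q s - perturb \<sigma> q s) = \<bar>\<tau> - \<sigma>\<bar> * N"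
    by (rule exists_second_order_invisible_step[of s0 \<Lambda> z, OF s0 z], rule that)
  show "\<exists>q. step_function 0 \<Lambda> q \<and>
        \<not> (AE s in lebesgue_on {0..\<Lambda>}. q s = 0) \<and>
        closure {s\<in>{0..\<Lambda>}. q s \<noteq> 0} \<subseteq> {s0..\<Lambda>} \<and>
        (\<forall>k. ((\<lambda>\<tau>. schur \<Lambda> (perturb \<tau> q) (z $ k)) has_vector_derivative 0) (at 0)) \<and>
        (\<exists>C \<tau>0 a b. \<tau>0 > 0 \<and> a > 0 \<and> b > 0 \<and>
           (\<forall>\<tau>. 0 < \<tau> \<and> \<tau> \<le> \<tau>0 \<longrightarrow>
              trace_normed \<Lambda> (perturb \<tau> q) \<and> trace_normed \<Lambda> (perturb (- \<tau>) q) \<and>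
              norm (sample_map \<Lambda> z (perturb \<tau> q) - sample_map \<Lambda> z (perturb (- \<tau>) q))
                \<le> C * \<tau>\<^sup>2 \<and>
              a * \<tau> \<le> L1_op \<Lambda> (\<lambda>s. perturb \<tau> q s - perturb (- \<tau>) q s) \<and>
              L1_op \<Lambda> (\<lambda>s. perturb \<tau> q s - perturb (- \<tau>) q s) \<le> b * \<tau>))"
  proof (intro exI[of _ q] conjI allI)
    show "closure {s\<in>{0..\<Lambda>}. q s \<noteq> 0} \<subseteq> {s0..\<Lambda>}"
      using supp by (intro closure_minimal) auto
    show "((\<lambda>\<tau>. schur \<Lambda> (perturb \<tau> q) (z $ k)) has_vector_derivative 0) (at 0)" for k
      by (rule has_vector_derivative_zero_quadratic[OF pos(1) schur])
    have "norm (sample_map \<Lambda> z (perturb \<tau> q) - sample_map \<Lambda> z (perturb (- \<tau>) q))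
        \<le> (2 * CARD('m) * C) * \<tau>\<^sup>2" if "0 < \<tau>" "\<tau> \<le> \<tau>0" for \<tau>
      using norm_sample_map_diff_le[of \<Lambda> "perturb \<tau> q" z "C * \<tau>\<^sup>2" "perturb (- \<tau>) q"]
        schur[of \<tau>] schur[of "- \<tau>"] that by (simp add: mult.assoc)
    then show "\<exists>C \<tau>0 a b. \<tau>0 > 0 \<and> a > 0 \<and> b > 0 \<and>
           (\<forall>\<tau>. 0 < \<tau> \<and> \<tau> \<le> \<tau>0 \<longrightarrow>
              trace_normed \<Lambda> (perturb \<tau> q) \<and> trace_normed \<Lambda> (perturb (- \<tau>) q) \<and>
              norm (sample_map \<Lambda> z (perturb \<tau> q) - sample_map \<Lambda> z (perturb (- \<tau>) q))
                \<le> C * \<tau>\<^sup>2 \<and>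
              a * \<tau> \<le> L1_op \<Lambda> (\<lambda>s. perturb \<tau> q s - perturb (- \<tau>) q s) \<and>
              L1_op \<Lambda> (\<lambda>s. perturb \<tau> q s - perturb (- \<tau>) q s) \<le> b * \<tau>)"
      \<comment> \<open>The distance between the two perturbations is exactly
        \<open>2 * N * \<tau>\<close>, so \<open>2 * N\<close> serves as both \<open>a\<close> and
        \<open>b\<close>.\<close>
      using pos tr
      by (intro exI[of _ "2 * CARD('m) * C"] exI[of _ \<tau>0] exI[of _ "2 * N"]) (auto simp: L1)
  qed (fact q)+
next
  have z: "0 < Im (z $ k)" for k using assms by simp
  obtain q C \<tau>0 N where pos: "0 < \<tau>0" "0 < N"
    and tr: "\<And>\<tau>. \<bar>\<tau>\<bar> \<le> \<tau>0 \<Longrightarrow> trace_normed \<Lambda> (perturb \<tau> q)"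
    and schur: "\<And>k \<tau>. \<bar>\<tau>\<bar> \<le> \<tau>0 \<Longrightarrow> norm (schur \<Lambda> (perturb \<tau> q) (z $ k)) \<le> C * \<tau>\<^sup>2"
    and L1: "\<And>\<tau> \<sigma>. L1_op \<Lambda> (\<lambda>s. perturb \<tau> q s - perturb \<sigma> q s) = \<bar>\<tau> - \<sigma>\<bar> * N"
    by (rule exists_second_order_invisible_step[of 0 \<Lambda> z, OF order_refl assms(1) z], rule that)
  assume "\<exists>U c. c > 0 \<and> L1_nbhd \<Lambda> H0 U \<and>
           (\<forall>H1\<in>U. \<forall>H2\<in>U.
              c * L1_op \<Lambda> (\<lambda>s. H1 s - H2 s)
                \<le> norm (sample_map \<Lambda> z H1 - sample_map \<Lambda> z H2))"
  then obtain U c where c: "0 < c" and nbhd: "L1_nbhd \<Lambda> H0 U"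
    and lip: "\<forall>H1\<in>U. \<forall>H2\<in>U. c * L1_op \<Lambda> (\<lambda>s. H1 s - H2 s)
        \<le> norm (sample_map \<Lambda> z H1 - sample_map \<Lambda> z H2)"
    by (elim exE conjE)
  obtain \<epsilon> where \<epsilon>: "0 < \<epsilon>"
    and U: "\<And>G. trace_normed \<Lambda> G \<Longrightarrow> L1_op \<Lambda> (\<lambda>s. G s - H0 s) < \<epsilon> \<Longrightarrow> G \<in> U"
    using nbhd unfolding L1_nbhd_def by blast
  \<comment> \<open>The sign of \<open>C\<close> is not known, hence the absolute value; the summand
    1 makes \<open>D\<close> a legitimate divisor.\<close>
  define D where "D = 2 * CARD('m) * \<bar>C\<bar> + 1"
  have D: "0 < D" by (simp add: D_def add_nonneg_pos)
  \<comment> \<open>The middle term puts both perturbations within \<open>\<epsilon> / 2\<close> of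
    \<open>H0\<close>. The last makes the sample difference at most \<open>c * N * \<tau>\<close>,
    half of the lower bound that the inverse estimate would force.\<close>
  define \<tau> where "\<tau> = min \<tau>0 (min (\<epsilon> / (2 * N)) (c * N / D))"
  have \<tau>: "0 < \<tau>" "\<tau> \<le> \<tau>0" "\<tau> \<le> \<epsilon> / (2 * N)" "\<tau> \<le> c * N / D"
    using pos c \<epsilon> D by (auto simp: \<tau>_def)
  have "\<tau> * N < \<epsilon>" "D * \<tau> \<le> c * N"
    using \<tau>(1,3,4) pos D \<epsilon> by (auto simp: field_simps)
  then have "perturb \<tau> q \<in> U" "perturb (- \<tau>) q \<in> U"
    using \<tau>(1,2) L1[of \<tau> 0] L1[of "- \<tau>" 0] by (auto intro!: U tr simp: perturb_0)
  then have "c * (2 * \<tau> * N) \<le> norm (sample_map \<Lambda> z (perturb \<tau> q) - sample_map \<Lambda> z (perturb (- \<tau>) q))"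
    using lip[rule_format, of "perturb \<tau> q" "perturb (- \<tau>) q"] \<tau>(1) by (simp add: L1)
  also have "\<dots> \<le> 2 * CARD('m) * (C * \<tau>\<^sup>2)"
    using schur[of \<tau>] schur[of "- \<tau>"] \<tau>(1,2) by (intro norm_sample_map_diff_le) auto
  also have "\<dots> \<le> 2 * CARD('m) * (\<bar>C\<bar> * \<tau>\<^sup>2)"
    by (intro mult_left_mono mult_right_mono) auto
  also have "\<dots> \<le> D * \<tau> * \<tau>"
    by (simp add: D_def power2_eq_square algebra_simps)
  also have "\<dots> \<le> c * N * \<tau>"
    using \<open>D * \<tau> \<le> c * N\<close> \<tau>(1) by (intro mult_right_mono) auto
  finally have "c * N * \<tau> \<le> 0" by (simp add: algebra_simps)
  then show False using c pos \<tau>(1) by (simp add: mult_le_0_iff)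
qed

end
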